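(* Let $F$ be an arbitrary field and $n\ge 2$ an integer. The set of maps $\mathbf{L}_\mathbf{u}\colon[0,\infty)\to\mathbb{R}^n$, where $\mathbf{u}$ runs through the elements of $K_\infty^n$ of norm $\|\mathbf{u}\|=1$, is equal to the set of $n$-systems $\mathbf{P}$ on $[0,\infty)$ such that $\mathbf{P}(q)\in\mathbb{Z}^n$ for each integer $q\ge 0$.
   Context: Let $A=F[T]$, $K=F(T)$, equipped with the absolute value $|f/g|=\exp(\deg f-\deg g)$ for $f,g\in A$, $g\ne0$ (with $\deg 0=-\infty$, $\exp(-\infty)=0$), and let $K_\infty=F((1/T))$ be the completion, with extended absolute value $|\cdot|$. On $K_\infty^n$ use the maximum norm $\|\mathbf{x}\|=\max_i|x_i|$ and the bilinear form $\mathbf{x}\cdot\mathbf{y}=x_1y_1+\cdots+x_ny_n$. For $\mathbf{u}\in K_\infty^n$ with $\|\mathbf{u}\|=1$, $i\in\{1,\dots,n\}$ and real $q\ge0$, let $L_{\mathbf{u},i}(q)$ be the minimum of all real $t\ge0$ such that the set of $\mathbf{x}\in A^n$ with $\|\mathbf{x}\|\le e^t$ and $|\mathbf{u}\cdot\mathbf{x}|\le e^{t-q}$ spans a $K$-subspace of $K^n$ of dimension at least $i$; put $\mathbf{L}_\mathbf{u}(q)=(L_{\mathbf{u},1}(q),\dots,L_{\mathbf{u},n}(q))$. Let $\mathbf{e}_1,\dots,\mathbf{e}_n$ be the canonical basis of $\mathbb{R}^n$. An $n$-system on $[0,\infty)$ is a map $\mathbf{P}=(P_1,\dots,P_n)\colon[0,\infty)\to\mathbb{R}^n$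 such that for each $q\ge0$: (S1) $0\le P_1(q)\le\cdots\le P_n(q)$ and $P_1(q)+\cdots+P_n(q)=q$; (S2) there exist $\epsilon>0$ and $k,\ell\in\{1,\dots,n\}$ with $\mathbf{P}(t)=\mathbf{P}(q)+(t-q)\mathbf{e}_\ell$ for $\max\{0,q-\epsilon\}\le t\le q$ and $\mathbf{P}(t)=\mathbf{P}(q)+(t-q)\mathbf{e}_k$ for $q\le t\le q+\epsilon$; (S3) if $q>0$ and the integers $k,\ell$ of (S2) satisfy $k>\ell$, then $P_\ell(q)=\cdots=P_k(q)$. *)

theory Defs
  imports
    Complex_Main
    "HOL-Library.FuncSet"
    "HOL-Computational_Algebra.Formal_Laurent_Series"
    "HOL-Computational_Algebra.Fraction_Field"
    "HOL-Computational_Algebra.Polynomial_Factorial"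
    "Jordan_Normal_Form.VS_Connect"
begin

text \<open>
  For a field \<open>F\<close> (the type variable \<open>'a\<close>), the ring \<open>A = F[T]\<close> is \<open>'a poly\<close>, its fraction field
  \<open>K = F(T)\<close> is \<open>'a poly fract\<close>, and \<open>K\<^sub>\<infinity> = F((1/T))\<close> is \<open>'a fls\<close>, where the
  formal variable \<open>fls_X\<close> plays the role of \<open>1/T\<close>, so that \<open>T\<close> is \<open>fls_X_inv\<close>.

  Vectors have an explicit length and are indexed from \<open>0\<close>: the coordinate with index \<open>i\<close> here is
  the coordinate with index \<open>i + 1\<close> in the usual numbering \<open>1, ..., n\<close>.
\<close>

definition poly_to_fls :: "'a::field poly \<Rightarrow> 'a fls" where
  "poly_to_fls p = poly (map_poly fls_const p) fls_X_inv"

definition fls_abs :: "'a::field fls \<Rightarrow> real" where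
  "fls_abs x = (if x = 0 then 0 else exp (- real_of_int (fls_subdegree x)))"

definition max_norm :: "'a::field fls vec \<Rightarrow> real" where
  "max_norm x = Max ((\<lambda>i. fls_abs (x $ i)) ` {..<dim_vec x})"

definition span_dim :: "nat \<Rightarrow> 'k::field vec set \<Rightarrow> nat" where
  "span_dim n S =
     vectorspace.dim class_ring (LinearCombinations.module.span_vs class_ring (module_vec TYPE('k) n) S)"

definition convex_body_points :: "nat \<Rightarrow> 'a::field fls vec \<Rightarrow> real \<Rightarrow> real \<Rightarrow> 'a poly vec set" where
  "convex_body_points n u q t =
     {x \<in> carrier_vec n. max_norm (map_vec poly_to_fls x) \<le> exp t \<and>
        fls_abs (u \<bullet> map_vec poly_to_fls x) \<le> exp (t - q)}"

text \<open>
  The minimum below exists: the admissible \<open>t\<close> include all \<open>t \<ge> q\<close> when \<open>i < n\<close> and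
  \<open>max_norm u = 1\<close>, and the set of points changes with \<open>t\<close> only at the values \<open>t\<close> with
  \<open>t\<close> or \<open>t - q\<close> an integer, where it is continuous from the right.
\<close>

definition L_coord :: "nat \<Rightarrow> 'a::field fls vec \<Rightarrow> nat \<Rightarrow> real \<Rightarrow> real" where
  "L_coord n u i q =
     (LEAST t. 0 \<le> t \<and> span_dim n (map_vec to_fract ` convex_body_points n u q t) \<ge> i + 1)"

text \<open>
  Maps on \<open>[0, \<infinity>)\<close> are represented as extensional functions on \<open>{0..}\<close>, so that equality
  of functions is equality of maps with that domain.
\<close>

definition L_map :: "nat \<Rightarrow> 'a::field fls vec \<Rightarrow> real \<Rightarrow> real vec" where
  "L_map n u = (\<lambda>q\<in>{0..}. vec n (\<lambda>i. L_coord n u i q))"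

definition n_system :: "nat \<Rightarrow> (real \<Rightarrow> real vec) \<Rightarrow> bool" where
  "n_system n P \<longleftrightarrow>
     P \<in> {0..} \<rightarrow>\<^sub>E carrier_vec n \<and>
     (\<forall>q\<ge>0.
        (\<forall>i<n. 0 \<le> P q $ i) \<and>
        (\<forall>i j. i \<le> j \<and> j < n \<longrightarrow> P q $ i \<le> P q $ j) \<and>
        (\<Sum>i<n. P q $ i) = q \<and>
        (\<exists>\<epsilon>>0. \<exists>k<n. \<exists>l<n.
           (\<forall>t. max 0 (q - \<epsilon>) \<le> t \<and> t \<le> q \<longrightarrow> P t = P q + (t - q) \<cdot>\<^sub>v unit_vec n l) \<and>
           (\<forall>t. q \<le> t \<and> t \<le> q + \<epsilon> \<longrightarrow> P t = P q + (t - q) \<cdot>\<^sub>v unit_vec n k) \<and>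
           (q > 0 \<and> k > l \<longrightarrow> (\<forall>i. l \<le> i \<and> i \<le> k \<longrightarrow> P q $ i = P q $ l))))"

text \<open>
  The embedding of \<open>F[T]\<close> is a ring homomorphism, and \<open>fls_abs\<close> extends the absolute value
  \<open>|f/g| = exp (deg f - deg g)\<close> of \<open>F(T)\<close>.
\<close>

lemma map_poly_fls_const_add:
  "map_poly fls_const (p + q) = map_poly fls_const p + map_poly fls_const (q :: 'a::field poly)"
  by (rule poly_eqI) (simp add: coeff_map_poly fls_plus_const)

lemma poly_to_fls_0 [simp]: "poly_to_fls 0 = 0"
  by (simp add: poly_to_fls_def)

lemma poly_to_fls_pCons:
  "poly_to_fls (pCons a p) = fls_const a + fls_X_inv * poly_to_fls (p :: 'a::field poly)"
  by (auto simp: poly_to_fls_def map_poly_pCons)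

lemma poly_to_fls_add: "poly_to_fls (p + q) = poly_to_fls p + poly_to_fls q"
  by (simp add: poly_to_fls_def map_poly_fls_const_add)

lemma poly_to_fls_smult: "poly_to_fls (Polynomial.smult a p) = fls_const a * poly_to_fls p"
  by (induction p) (simp_all add: poly_to_fls_pCons algebra_simps fls_const_mult_const)

lemma poly_to_fls_mult: "poly_to_fls (p * q) = poly_to_fls p * poly_to_fls q"
  by (induction p) (simp_all add: poly_to_fls_pCons poly_to_fls_add poly_to_fls_smult algebra_simps)

lemma poly_to_fls_1: "poly_to_fls 1 = (1 :: 'a::field fls)"
  unfolding one_pCons by (simp add: poly_to_fls_pCons)

lemma fls_abs_mult: "fls_abs (x * y) = fls_abs x * fls_abs y"
  by (simp add: fls_abs_def exp_add [symmetric])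

lemma fls_nth_poly_to_fls: "fls_nth (poly_to_fls p) k = (if k \<le> 0 then Polynomial.coeff p (nat (- k)) else 0)"
proof (induction p arbitrary: k)
  case 0
  show ?case by simp
next
  case (pCons a p)
  have "nat (- k) = Suc (nat (- (k + 1)))" if "k < 0"
    using that by simp
  then show ?case
    by (auto simp: poly_to_fls_pCons pCons.IH fls_X_inv_times_conv_shift coeff_pCons split: nat.splits)
qed

lemma poly_to_fls_eq_0_iff: "poly_to_fls p = 0 \<longleftrightarrow> p = 0"
proof
  assume "poly_to_fls p = 0"
  then have "fls_nth (poly_to_fls p) (- int i) = 0" for i
    by simp
  then show "p = 0"
    by (intro poly_eqI) (simp add: fls_nth_poly_to_fls)
qed simp

lemma fls_abs_poly_to_fls:
  assumes "p \<noteq> 0"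
  shows "fls_abs (poly_to_fls p) = exp (real (degree p))"
proof -
  have "fls_subdegree (poly_to_fls p) = - int (degree p)"
    by (rule fls_subdegree_eqI) (use assms in \<open>auto simp: fls_nth_poly_to_fls intro: coeff_eq_0\<close>)
  with assms show ?thesis
    by (simp add: fls_abs_def poly_to_fls_eq_0_iff)
qed

lemma fls_abs_quotient:
  assumes "f \<noteq> 0" "g \<noteq> 0"
  shows "fls_abs (poly_to_fls f / poly_to_fls g) = exp (real (degree f) - real (degree g))"
proof -
  have "fls_abs (poly_to_fls f / poly_to_fls g) * fls_abs (poly_to_fls g) = fls_abs (poly_to_fls f)"
    using assms by (simp flip: fls_abs_mult add: poly_to_fls_eq_0_iff)
  with assms show ?thesis
    by (simp add: fls_abs_poly_to_fls exp_diff field_simps)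
qed

end

theory Submission
  imports Defs
begin

text \<open>
  At an integer \<open>q\<close> the lattice \<open>A\<^sup>n\<close> has a basis \<open>x\<^sub>1, ..., x\<^sub>n\<close> that is orthogonal for the gauge of
  the convex body: \<open>\<Sum> c\<^sub>i x\<^sub>i\<close> has gauge \<open>max (deg c\<^sub>i + p\<^sub>i)\<close>, so that the \<open>p\<^sub>i\<close> are the logarithms of
  the successive minima. Passing from \<open>q\<close> to \<open>q + 1\<close>, the gauge of \<open>x\<^sub>i\<close> increases, by \<open>1\<close>, exactly
  when the coefficient \<open>r\<^sub>i\<close> of \<open>u \<bullet> x\<^sub>i\<close> in the extremal degree \<open>p\<^sub>i - q\<close> is nonzero. Let \<open>k\<close> have
  minimal \<open>p\<^sub>k\<close> among the indices with \<open>r\<^sub>k \<noteq> 0\<close>; subtracting multiples of \<open>x\<^sub>k\<close> makes the other \<open>r\<^sub>i\<close>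
  vanish, and the new basis is orthogonal on all of \<open>[q, q + 1]\<close> with only \<open>p\<^sub>k\<close> growing. The vector
  that has just grown keeps a nonzero coefficient, so the next index \<open>k'\<close> satisfies \<open>p\<^sub>k\<^sub>' \<le> p\<^sub>k\<close>:
  this is condition (S3).

  Conversely, the vector that has just grown has norm less than \<open>exp p\<^sub>k\<close>, and the leading coefficients
  of the others are linearly independent over \<open>F\<close>. Hence the next coefficient of \<open>u\<close> can be chosen
  so as to prescribe \<open>r\<^sub>i\<close> for all \<open>i \<noteq> k\<close>, and every system obeying (S3) can be followed.
\<close>

section \<open>Convex bodies and orthogonal bases\<close>

text \<open>Since \<open>fls_X_inv\<close> is T, each factor T moves the coefficient index by one.
  The bound \<open>D\<close> is free because a later sum must reach a degree that may exceed
  \<open>degree c\<close>.\<close>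

lemma fls_nth_poly_to_fls_mult:
  fixes g :: "'a::field fls"
  assumes "degree c \<le> D"
  shows "fls_nth (poly_to_fls c * g) k = (\<Sum>d\<le>D. poly.coeff c d * fls_nth g (k + int d))"
  using assms
proof (induction c arbitrary: k D)
  case 0
  then show ?case by simp
next
  case (pCons a c)
  show ?case
  proof (cases D)
    case 0
    with pCons have "c = 0"
      by (metis degree_pCons_eq le_zero_eq nat.distinct(1))
    with 0 show ?thesis
      by (simp add: poly_to_fls_pCons)
  next
    case (Suc D')
    have "degree c \<le> D'"
      using pCons.prems Suc by (cases "c = 0") simp_all
    then have "fls_nth (poly_to_fls c * g) (k + 1) = (\<Sum>d\<le>D'. poly.coeff c d * fls_nth g (k + 1 + int d))"
      by (rule pCons.IH)
    moreover have "poly_to_fls (pCons a c) * g = fls_const a * g + fls_X_inv * (poly_to_fls c * g)"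
      by (simp add: poly_to_fls_pCons algebra_simps)
    ultimately show ?thesis
      by (simp add: Suc sum.atMost_Suc_shift algebra_simps
          fls_X_inv_times_conv_shift del: sum.atMost_Suc)
  qed
qed

definition linear_form :: "nat \<Rightarrow> (nat \<Rightarrow> 'a::field fls) \<Rightarrow> (nat \<Rightarrow> 'a poly) \<Rightarrow> 'a fls" where
  "linear_form n u x = (\<Sum>j<n. u j * poly_to_fls (x j))"

text \<open>Index k of a Laurent series stands for T^(-k), so |f| \<le> exp s says that nonzero
  coefficients have index at least -s. In this form the zero vector needs no exception.\<close>

definition in_body ::
    "nat \<Rightarrow> (nat \<Rightarrow> 'a::field fls) \<Rightarrow> real \<Rightarrow> real \<Rightarrow> (nat \<Rightarrow> 'a poly) \<Rightarrow> bool" where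
  "in_body n u q t x \<longleftrightarrow>
     (\<forall>j<n. \<forall>d. poly.coeff (x j) d \<noteq> 0 \<longrightarrow> real d \<le> t) \<and>
     (\<forall>k. fls_nth (linear_form n u x) k \<noteq> 0 \<longrightarrow> q - t \<le> real_of_int k)"

definition combination :: "nat \<Rightarrow> (nat \<Rightarrow> 'a::field poly) \<Rightarrow> (nat \<Rightarrow> nat \<Rightarrow> 'a poly) \<Rightarrow> nat \<Rightarrow> 'a poly" where
  "combination n c X j = (\<Sum>i<n. c i * X i j)"

definition weighted_degrees_le :: "nat \<Rightarrow> (nat \<Rightarrow> real) \<Rightarrow> real \<Rightarrow> (nat \<Rightarrow> 'a::field poly) \<Rightarrow> bool" where
  "weighted_degrees_le n p t c \<longleftrightarrow> (\<forall>i<n. \<forall>d. poly.coeff (c i) d \<noteq> 0 \<longrightarrow> real d + p i \<le> t)"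

text \<open>
  The condition for all \<open>t\<close> says that the gauge of \<open>\<Sum> c\<^sub>i X\<^sub>i\<close> is \<open>max (deg c\<^sub>i + p\<^sub>i)\<close>. It includes linear
  independence of the \<open>X\<^sub>i\<close>, because \<open>0\<close> lies in the body for every \<open>t\<close>.
\<close>

definition reduced_basis ::
    "nat \<Rightarrow> (nat \<Rightarrow> 'a::field fls) \<Rightarrow> real \<Rightarrow> (nat \<Rightarrow> real) \<Rightarrow> (nat \<Rightarrow> nat \<Rightarrow> 'a poly) \<Rightarrow> bool" where
  "reduced_basis n u q p X \<longleftrightarrow>
     (\<forall>x. \<exists>c. \<forall>j<n. x j = combination n c X j) \<and>
     (\<forall>c t. in_body n u q t (combination n c X) \<longleftrightarrow> weighted_degrees_le n p t c)"

lemma fls_abs_le_exp_iff: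
  "fls_abs (x :: 'a::field fls) \<le> exp s \<longleftrightarrow> (\<forall>k. fls_nth x k \<noteq> 0 \<longrightarrow> - s \<le> real_of_int k)"
proof (cases "x = 0")
  case False
  then have "fls_abs x \<le> exp s \<longleftrightarrow> - s \<le> real_of_int (fls_subdegree x)"
    by (auto simp: fls_abs_def)
  also have "\<dots> \<longleftrightarrow> (\<forall>k. fls_nth x k \<noteq> 0 \<longrightarrow> - s \<le> real_of_int k)"
    using nth_fls_subdegree_nonzero[OF False] fls_subdegree_leI[of x]
    by (meson of_int_le_iff order_trans)
  finally show ?thesis .
qed (simp add: fls_abs_def)

lemma fls_abs_poly_to_fls_le_exp_iff:
  "fls_abs (poly_to_fls x) \<le> exp t \<longleftrightarrow> (\<forall>d. poly.coeff x d \<noteq> 0 \<longrightarrow> real d \<le> t)"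
proof -
  have "(\<forall>k. fls_nth (poly_to_fls x) k \<noteq> 0 \<longrightarrow> - t \<le> real_of_int k) \<longleftrightarrow>
        (\<forall>d. poly.coeff x d \<noteq> 0 \<longrightarrow> real d \<le> t)" (is "?L \<longleftrightarrow> ?R")
  proof
    assume L: ?L
    show ?R
    proof (intro allI impI)
      fix d assume "poly.coeff x d \<noteq> 0"
      then have "fls_nth (poly_to_fls x) (- int d) \<noteq> 0"
        by (simp add: fls_nth_poly_to_fls)
      with L show "real d \<le> t"
        by fastforce
    qed
  next
    assume R: ?R
    show ?L
    proof (intro allI impI)
      fix k assume "fls_nth (poly_to_fls x) k \<noteq> 0"
      then have "k \<le> 0" "poly.coeff x (nat (- k)) \<noteq> 0"
        by (auto simp: fls_nth_poly_to_fls split: if_splits)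
      with R have "real (nat (- k)) \<le> t"
        by blast
      with \<open>k \<le> 0\<close> show "- t \<le> real_of_int k"
        by simp
    qed
  qed
  then show ?thesis
    by (simp add: fls_abs_le_exp_iff)
qed

lemma mem_convex_body_points_iff:
  fixes u :: "'a::field fls vec"
  assumes "0 < n" "x \<in> carrier_vec n"
  shows "x \<in> convex_body_points n u q t \<longleftrightarrow> in_body n (vec_index u) q t (vec_index x)"
proof -
  have "u \<bullet> map_vec poly_to_fls x = linear_form n (vec_index u) (vec_index x)"
    using assms unfolding scalar_prod_def linear_form_def
    by (auto simp: atLeast0LessThan intro!: sum.cong)
  moreover have "max_norm (map_vec poly_to_fls x) \<le> exp t \<longleftrightarrow>
      (\<forall>j<n. \<forall>d. poly.coeff (vec_index x j) d \<noteq> 0 \<longrightarrow> real d \<le> t)"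
    using assms by (auto simp: max_norm_def fls_abs_poly_to_fls_le_exp_iff Max_le_iff lessThan_empty_iff)
  ultimately show ?thesis
    using assms(2) by (simp add: convex_body_points_def in_body_def fls_abs_le_exp_iff)
qed


section \<open>Successive minima from an orthogonal basis\<close>

context vec_space
begin

lemma sum_smult_in_span:
  assumes Z: "Z \<subseteq> carrier_vec n" and "finite I" and Y: "\<And>i. i \<in> I \<Longrightarrow> Y i \<in> span Z"
  shows "vec n (\<lambda>j. \<Sum>i\<in>I. a i * vec_index (Y i) j) \<in> span Z"
  using \<open>finite I\<close> Y
proof (induction I)
  case empty
  have "vec n (\<lambda>j. \<Sum>i\<in>{}. a i * vec_index (Y i) j) = 0\<^sub>v n"
    by auto
  then show ?case
    using span_zero by simp
next
  case (insert i I)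
  let ?s = "vec n (\<lambda>j. \<Sum>i\<in>I. a i * vec_index (Y i) j)"
  have Yi: "Y i \<in> span Z" "Y i \<in> carrier_vec n"
    using insert.prems Z span_is_subset2[of Z] by auto
  have "vec n (\<lambda>j. \<Sum>i\<in>insert i I. a i * vec_index (Y i) j) = a i \<cdot>\<^sub>v Y i + ?s"
    using insert.hyps Yi by auto
  then show ?case
    using insert Yi Z by (auto intro!: span_add1 smult_in_span)
qed

lemma span_dim_eq_card:
  assumes Z: "Z \<subseteq> carrier_vec n" and indpt: "lin_indpt Z"
    and "Z \<subseteq> S" "S \<subseteq> span Z"
  shows "span_dim n S = card Z"
proof -
  have "finite Z"
    using fin_dim_li_fin[OF fin_dim indpt] Z by simp
  have S: "S \<subseteq> carrier_vec n"
    using assms span_is_subset2[of Z] by auto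
  have "span S \<subseteq> span (span Z)"
    using \<open>S \<subseteq> span Z\<close> by (rule span_is_monotone)
  moreover have "span Z \<subseteq> span S"
    using \<open>Z \<subseteq> S\<close> by (rule span_is_monotone)
  ultimately have eq: "span S = span Z"
    using Z by simp
  have sub: "submodule class_ring (span Z) V" "Z \<subseteq> span Z"
    using Z span_is_submodule[of Z] in_own_span[of Z] by auto
  have vs: "vectorspace class_ring (vs (span Z))"
    using Z span_is_subspace[of Z] subspace_is_vs by simp
  have "vectorspace.basis class_ring (vs (span Z)) Z"
    using span_li_not_depend[OF sub(2,1)] indpt sub(2)
    by (simp add: vectorspace.basis_def[OF vs])
  then have "vectorspace.dim class_ring (vs (span Z)) = card Z"
    using vectorspace.dim_basis[OF vs \<open>finite Z\<close>] by simp
  then show ?thesis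
    by (simp add: span_dim_def eq)
qed

lemma spanning_family_indpt:
  assumes Y: "\<And>i. i < n \<Longrightarrow> Y i \<in> carrier_vec n"
    and gen: "\<And>j. j < n \<Longrightarrow> unit_vec n j \<in> span (Y ` {..<n})"
  shows "inj_on Y {..<n}" "lin_indpt (Y ` {..<n})"
proof -
  have Yc: "Y ` {..<n} \<subseteq> carrier_vec n"
    using Y by auto
  have "set (unit_vecs n) \<subseteq> span (Y ` {..<n})"
    using gen by (auto simp: unit_vecs_def)
  then have "span (set (unit_vecs n)) \<subseteq> span (span (Y ` {..<n}))"
    by (rule span_is_monotone)
  then have g: "span (Y ` {..<n}) = carrier_vec n"
    using span_unit_vecs_is_carrier Yc span_is_subset2[of "Y ` {..<n}"] by auto
  then have "n \<le> card (Y ` {..<n})"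
    using gen_ge_dim[of "Y ` {..<n}"] Yc dim_is_n by simp
  then show "inj_on Y {..<n}"
    by (intro eq_card_imp_inj_on) (use card_image_le[of "{..<n}" Y] in auto)
  have "basis (Y ` {..<n})"
    using dim_gen_is_basis[of "Y ` {..<n}"] Yc dim_is_n g card_image_le[of "{..<n}" Y] by simp
  then show "lin_indpt (Y ` {..<n})"
    by (simp add: basis_def)
qed

end

text \<open>The \<open>X i\<close> generate \<open>A^n\<close> over A, hence \<open>K^n\<close> over
  K, so they are independent over K. Those with \<open>p i \<le> t\<close> lie in the body, and
  every point of the body is a combination of these alone: \<open>degree (c i) + p i \<le> t\<close>
  is impossible for nonzero \<open>c i\<close> when \<open>p i > t\<close>.\<close>

lemma span_dim_convex_body_points:
  fixes u :: "'a::field fls vec"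
  assumes "0 < n" and red: "reduced_basis n (vec_index u) q p X"
  shows "span_dim n (map_vec to_fract ` convex_body_points n u q t) = card {i. i < n \<and> p i \<le> t}"
proof -
  interpret vec_space "TYPE('a poly fract)" n .
  define Y where "Y i = vec n (\<lambda>j. to_fract (X i j))" for i
  have Yc: "Y i \<in> carrier_vec n" for i
    by (simp add: Y_def)
  define I where "I = {i. i < n \<and> p i \<le> t}"
  have comb: "map_vec to_fract x = vec n (\<lambda>j. \<Sum>i<n. to_fract (c i) * vec_index (Y i) j)"
    if "x \<in> carrier_vec n" "\<forall>j<n. vec_index x j = combination n c X j" for x c
  proof
    fix j assume "j < dim_vec (vec n (\<lambda>j. \<Sum>i<n. to_fract (c i) * vec_index (Y i) j))"
    moreover have "to_fract (\<Sum>i<n. c i * X i j) = (\<Sum>i<n. to_fract (c i) * to_fract (X i j))"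
      by (induction n) simp_all
    ultimately show "vec_index (map_vec to_fract x) j =
        vec_index (vec n (\<lambda>j. \<Sum>i<n. to_fract (c i) * vec_index (Y i) j)) j"
      using that by (simp add: combination_def Y_def)
  qed (use that in simp)
  have "unit_vec n j \<in> span (Y ` {..<n})" if "j < n" for j
  proof -
    obtain c where c: "\<forall>j'<n. vec_index (unit_vec n j) j' = combination n c X j'"
      using red unfolding reduced_basis_def by blast
    have "unit_vec n j = map_vec to_fract (unit_vec n j :: 'a poly vec)"
      by (auto simp: unit_vec_def)
    also have "\<dots> \<in> span (Y ` {..<n})"
      unfolding comb[OF _ c, simplified]
      by (rule sum_smult_in_span) (use Yc in \<open>auto intro!: span_mem\<close>)
    finally show ?thesis .
  qed
  then have inj: "inj_on Y {..<n}" and indpt: "lin_indpt (Y ` {..<n})"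
    using spanning_family_indpt[of Y] Yc by auto
  have sub: "Y ` I \<subseteq> Y ` {..<n}"
    by (auto simp: I_def)
  have "span_dim n (map_vec to_fract ` convex_body_points n u q t) = card (Y ` I)"
  proof (rule span_dim_eq_card)
    show "Y ` I \<subseteq> carrier_vec n"
      using Yc by auto
    show "lin_indpt (Y ` I)"
      using indpt sub subset_li_is_li by blast
    show "Y ` I \<subseteq> map_vec to_fract ` convex_body_points n u q t"
    proof
      fix y assume "y \<in> Y ` I"
      then obtain i where i: "i < n" "p i \<le> t" "y = Y i"
        by (auto simp: I_def)
      define c :: "nat \<Rightarrow> 'a poly" where "c = (\<lambda>i'. if i' = i then 1 else 0)"
      have "combination n c X = X i"
        using i by (auto simp: combination_def c_def if_distrib[of "\<lambda>x. x * _"] cong: if_cong)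
      moreover have "weighted_degrees_le n p t c"
        using i by (auto simp: weighted_degrees_le_def c_def split: if_splits)
      ultimately have "in_body n (vec_index u) q t (X i)"
        using red unfolding reduced_basis_def by metis
      moreover have "in_body n (vec_index u) q t (vec_index (vec n (X i))) =
          in_body n (vec_index u) q t (X i)"
        by (simp add: in_body_def linear_form_def)
      ultimately have "vec n (X i) \<in> convex_body_points n u q t"
        using mem_convex_body_points_iff[OF \<open>0 < n\<close>, of "vec n (X i)" u q t] by simp
      moreover have "y = map_vec to_fract (vec n (X i))"
        by (auto simp: i Y_def)
      ultimately show "y \<in> map_vec to_fract ` convex_body_points n u q t"
        by blast
    qed
    show "map_vec to_fract ` convex_body_points n u q t \<subseteq> span (Y ` I)"
    proof
      fix y assume "y \<in> map_vec to_fract ` convex_body_points n u q t"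
      then obtain x where x: "x \<in> convex_body_points n u q t" and y: "y = map_vec to_fract x"
        by blast
      then have xc: "x \<in> carrier_vec n"
        by (simp add: convex_body_points_def)
      obtain c where c: "\<forall>j<n. vec_index x j = combination n c X j"
        using red unfolding reduced_basis_def by blast
      have "in_body n (vec_index u) q t (vec_index x) = in_body n (vec_index u) q t (combination n c X)"
        using c by (simp add: in_body_def linear_form_def)
      then have "weighted_degrees_le n p t c"
        using x red mem_convex_body_points_iff[OF \<open>0 < n\<close> xc, of u q t]
        by (simp add: reduced_basis_def)
      have c0: "c i = 0" if "i < n" "i \<notin> I" for i
      proof (rule ccontr)
        assume "c i \<noteq> 0"
        then have "poly.coeff (c i) (degree (c i)) \<noteq> 0"
          by simp
        with \<open>weighted_degrees_le n p t c\<close> \<open>i < n\<close> have "real (degree (c i)) + p i \<le> t"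
          unfolding weighted_degrees_le_def by blast
        with that show False
          by (simp add: I_def)
      qed
      have "y = vec n (\<lambda>j. \<Sum>i<n. to_fract (c i) * vec_index (Y i) j)"
        unfolding y by (rule comb[OF xc c])
      also have "\<dots> = vec n (\<lambda>j. \<Sum>i\<in>I. to_fract (c i) * vec_index (Y i) j)"
        using c0 by (intro arg_cong[of _ _ "vec n"] ext sum.mono_neutral_right) (auto simp: I_def)
      also have "\<dots> \<in> span (Y ` I)"
        by (rule sum_smult_in_span) (use Yc in \<open>auto simp: I_def intro!: span_mem\<close>)
      finally show "y \<in> span (Y ` I)" .
    qed
  qed
  also have "card (Y ` I) = card I"
    by (rule card_image) (use inj in \<open>auto simp: I_def inj_on_def\<close>)
  finally show ?thesis
    by (simp add: I_def)
qed

text \<open>Because \<open>p\<close> is sorted, at least \<open>i + 1\<close> of its values are at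
  most t exactly when \<open>p i\<close> is. The admissible t thus form a half-line from
  \<open>p i\<close>, whose endpoint is allowed by \<open>0 \<le> p i\<close>.\<close>

lemma L_coord_eqI:
  fixes u :: "'a::field fls vec"
  assumes "0 < n" "i < n" and red: "reduced_basis n (vec_index u) q p X"
    and nonneg: "0 \<le> p i" and sorted: "\<And>i j. i \<le> j \<Longrightarrow> j < n \<Longrightarrow> p i \<le> p j"
  shows "L_coord n u i q = p i"
proof -
  have card: "i + 1 \<le> card {j. j < n \<and> p j \<le> t} \<longleftrightarrow> p i \<le> t" for t
  proof
    assume "i + 1 \<le> card {j. j < n \<and> p j \<le> t}"
    then have "\<not> {j. j < n \<and> p j \<le> t} \<subseteq> {..<i}"
      using card_mono[of "{..<i}" "{j. j < n \<and> p j \<le> t}"] by auto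
    then obtain j where "j < n" "p j \<le> t" "i \<le> j"
      using not_less by blast
    with sorted show "p i \<le> t"
      using order_trans by blast
  next
    assume "p i \<le> t"
    then have "{..i} \<subseteq> {j. j < n \<and> p j \<le> t}"
      using sorted[of _ i] \<open>i < n\<close> by (auto intro: order_trans)
    from card_mono[OF _ this] show "i + 1 \<le> card {j. j < n \<and> p j \<le> t}"
      by simp
  qed
  show ?thesis
    unfolding L_coord_def span_dim_convex_body_points[OF \<open>0 < n\<close> red] card
    by (rule Least_equality) (use nonneg in auto)
qed


section \<open>Passing from an integer to the next\<close>

lemma poly_to_fls_sum: "poly_to_fls (sum f I) = (\<Sum>i\<in>I. poly_to_fls (f i))"
  by (induction I rule: infinite_finite_induct) (simp_all add: poly_to_fls_add)

lemma poly_to_fls_minus: "poly_to_fls (- p) = - poly_to_fls p"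
  using poly_to_fls_add[of p "- p"] by (simp add: eq_neg_iff_add_eq_0 add.commute)

lemma poly_to_fls_diff: "poly_to_fls (p - q) = poly_to_fls p - poly_to_fls q"
  using poly_to_fls_add[of p "- q"] by (simp add: poly_to_fls_minus)

lemma fls_nth_monom_mult:
  fixes g :: "'a::field fls"
  shows "fls_nth (poly_to_fls (Polynomial.monom a e) * g) k = a * fls_nth g (k + int e)"
proof -
  have "fls_nth (poly_to_fls (Polynomial.monom a e) * g) k =
      (\<Sum>d\<le>e. poly.coeff (Polynomial.monom a e) d * fls_nth g (k + int d))"
    by (rule fls_nth_poly_to_fls_mult) (rule degree_monom_le)
  also have "\<dots> = (\<Sum>d\<in>{e}. poly.coeff (Polynomial.monom a e) d * fls_nth g (k + int d))"
    by (rule sum.mono_neutral_right) auto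
  finally show ?thesis
    by simp
qed

lemma fls_nth_linear_form:
  "fls_nth (linear_form n u x) k =
     (\<Sum>j<n. \<Sum>d\<le>degree (x j). poly.coeff (x j) d * fls_nth (u j) (k + int d))"
  by (simp add: linear_form_def fls_nth_sum fls_nth_poly_to_fls_mult[OF order_refl] mult.commute[of "u _"])

lemma linear_form_combination:
  "linear_form n u (combination n c X) = (\<Sum>i<n. poly_to_fls (c i) * linear_form n u (X i))"
proof -
  have "linear_form n u (combination n c X) =
      (\<Sum>j<n. \<Sum>i<n. u j * (poly_to_fls (c i) * poly_to_fls (X i j)))"
    by (simp add: linear_form_def combination_def poly_to_fls_sum poly_to_fls_mult sum_distrib_left)
  also have "\<dots> = (\<Sum>i<n. \<Sum>j<n. u j * (poly_to_fls (c i) * poly_to_fls (X i j)))"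
    by (rule sum.swap)
  finally show ?thesis
    by (simp add: linear_form_def sum_distrib_left mult.left_commute)
qed

text \<open>At parameter m a forbidden index k of \<open>u \<bullet> x\<close> satisfies
  \<open>k < m - t\<close>, and a term of degree \<open>d \<le> t\<close> in x only meets index
  \<open>k + d < m\<close> of \<open>u\<close>. This is what lets \<open>u\<close> be built
  coefficient by coefficient.\<close>

lemma in_body_cong:
  assumes agree: "\<And>j k. j < n \<Longrightarrow> k < int m \<Longrightarrow> fls_nth (u j) k = fls_nth (u' j) k"
  shows "in_body n u (real m) t x \<longleftrightarrow> in_body n u' (real m) t x"
proof (cases "\<forall>j<n. \<forall>d. poly.coeff (x j) d \<noteq> 0 \<longrightarrow> real d \<le> t")
  case True
  have "fls_nth (linear_form n u x) k = fls_nth (linear_form n u' x) k"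
    if "\<not> real m - t \<le> real_of_int k" for k
  proof -
    have "poly.coeff (x j) d * fls_nth (u j) (k + int d) =
        poly.coeff (x j) d * fls_nth (u' j) (k + int d)" if "j < n" for j d
    proof (cases "poly.coeff (x j) d = 0")
      case False
      with True \<open>j < n\<close> have "real d \<le> t"
        by blast
      with \<open>\<not> real m - t \<le> real_of_int k\<close> have "k + int d < int m"
        by linarith
      with agree \<open>j < n\<close> show ?thesis
        by simp
    qed simp
    then show ?thesis
      unfolding fls_nth_linear_form by (intro sum.cong) simp_all
  qed
  then show ?thesis
    unfolding in_body_def by metis
qed (auto simp: in_body_def)

lemma reduced_basis_cong:
  assumes "\<And>j k. j < n \<Longrightarrow> k < int m \<Longrightarrow> fls_nth (u j) k = fls_nth (u' j) k"
  shows "reduced_basis n u (real m) p X \<longleftrightarrow> reduced_basis n u' (real m) p X"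
  using in_body_cong[of n m u u', OF assms] by (simp add: reduced_basis_def)

lemma in_body_floor_iff:
  "in_body n u q t x \<longleftrightarrow>
     (\<forall>j<n. \<forall>d. poly.coeff (x j) d \<noteq> 0 \<longrightarrow> int d \<le> \<lfloor>t\<rfloor>) \<and>
     (\<forall>k. fls_nth (linear_form n u x) k \<noteq> 0 \<longrightarrow> \<lceil>q - t\<rceil> \<le> k)"
  by (simp add: in_body_def le_floor_iff ceiling_le_iff)

section \<open>Reduced bases at integers and along a unit interval\<close>

lemma combination_unit:
  assumes "i < n"
  shows "combination n (\<lambda>i'. if i' = i then 1 else 0) X = X i"
  using assms by (auto simp: combination_def if_distrib[of "\<lambda>x. x * _"] cong: if_cong)

lemma reduced_basis_in_body:
  assumes "reduced_basis n u q p X" "i < n"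
  shows "in_body n u q (p i) (X i)"
proof -
  have "weighted_degrees_le n p (p i) (\<lambda>i'. if i' = i then 1 else 0 :: 'a poly)"
    by (auto simp: weighted_degrees_le_def split: if_splits)
  then show ?thesis
    using assms combination_unit[OF \<open>i < n\<close>] by (metis reduced_basis_def)
qed

text \<open>When |u_j| \<le> 1, the bound on \<open>u \<bullet> x\<close> at parameter 0 follows
  from the bound on x. Formally, \<open>in_body_cong\<close> at \<open>m = 0\<close> replaces
  \<open>u\<close> by zero, and only degrees remain.\<close>

lemma reduced_basis_unit:
  assumes "\<And>j k. j < n \<Longrightarrow> k < 0 \<Longrightarrow> fls_nth (u j) k = 0"
  shows "reduced_basis n u 0 (\<lambda>i. 0) (\<lambda>i j. if i = j then 1 else 0)"
proof -
  have comb: "combination n c (\<lambda>i j. if i = j then 1 else 0) j = c j" if "j < n" for c :: "nat \<Rightarrow> 'a poly" and j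
    using that by (simp add: combination_def if_distrib[of "\<lambda>x. _ * x"] cong: if_cong)
  have "in_body n u 0 t (combination n c (\<lambda>i j. if i = j then 1 else 0)) \<longleftrightarrow>
      weighted_degrees_le n (\<lambda>i. 0) t c" for c t
  proof -
    let ?x = "combination n c (\<lambda>i j. if i = j then 1 else 0)"
    have "in_body n u 0 t ?x \<longleftrightarrow> in_body n (\<lambda>j. 0) 0 t ?x"
      using in_body_cong[of n 0 u "\<lambda>j. 0" t ?x] assms by simp
    also have "\<dots> \<longleftrightarrow> weighted_degrees_le n (\<lambda>i. 0) t c"
      by (simp add: in_body_def weighted_degrees_le_def comb linear_form_def)
    finally show ?thesis .
  qed
  then show ?thesis
    using comb by (auto simp: reduced_basis_def)
qed

text \<open>
  The coefficient of \<open>u \<bullet> X\<^sub>i\<close> in the largest degree allowed at parameter \<open>m\<close> and level \<open>p\<^sub>i\<close>; at parameter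
  \<open>m + 1\<close> this degree is no longer allowed.
\<close>

definition residue ::
    "nat \<Rightarrow> (nat \<Rightarrow> 'a::field fls) \<Rightarrow> nat \<Rightarrow> (nat \<Rightarrow> nat) \<Rightarrow> (nat \<Rightarrow> nat \<Rightarrow> 'a poly) \<Rightarrow> nat \<Rightarrow> 'a" where
  "residue n u m p X i = fls_nth (linear_form n u (X i)) (int m - int (p i))"

text \<open>Only terms of weighted degree exactly \<open>N\<close> contribute. A term of degree d in
  \<open>c i\<close> meets index \<open>m - N + d\<close> of \<open>u \<bullet> X i\<close>. If
  \<open>d + p i < N\<close>, that coefficient vanishes because \<open>X i\<close> lies in the body
  at level \<open>p i\<close>; if \<open>d + p i > N\<close>, \<open>c i\<close> has no such
  term.\<close>

lemma fls_nth_linear_form_combination: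
  assumes red: "reduced_basis n u (real m) (\<lambda>i. real (p i)) X"
    and deg: "weighted_degrees_le n (\<lambda>i. real (p i)) (real_of_int N) c"
  shows "fls_nth (linear_form n u (combination n c X)) (int m - N) =
    (\<Sum>i<n. if int (p i) \<le> N then poly.coeff (c i) (nat (N - int (p i))) * residue n u m p X i else 0)"
proof -
  have "fls_nth (poly_to_fls (c i) * linear_form n u (X i)) (int m - N) =
      (if int (p i) \<le> N then poly.coeff (c i) (nat (N - int (p i))) * residue n u m p X i else 0)"
    if "i < n" for i
  proof -
    \<comment> \<open>The maximum keeps the degree \<open>N - p i\<close> in range even when it
      exceeds \<open>degree (c i)\<close>.\<close>
    let ?D = "max (degree (c i)) (nat (N - int (p i)))"
    let ?f = "\<lambda>d. poly.coeff (c i) d * fls_nth (linear_form n u (X i)) (int m - N + int d)"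
    let ?S = "{d. int d = N - int (p i)}"
    have f0: "?f d = 0" if "d \<notin> ?S" for d
    proof (cases "int d + int (p i) \<le> N")
      case True
      then have "int m - N + int d < int m - int (p i)"
        using that by auto
      then have "\<not> real m - real (p i) \<le> real_of_int (int m - N + int d)"
        by linarith
      then show ?thesis
        using reduced_basis_in_body[OF red \<open>i < n\<close>] unfolding in_body_def by (metis mult_zero_right)
    next
      case False
      then have "\<not> real d + real (p i) \<le> real_of_int N"
        by linarith
      then show ?thesis
        using deg \<open>i < n\<close> unfolding weighted_degrees_le_def by (metis mult_zero_left)
    qed
    have S: "?S = (if int (p i) \<le> N then {nat (N - int (p i))} else {})"
      by auto
    have "fls_nth (poly_to_fls (c i) * linear_form n u (X i)) (int m - N) = (\<Sum>d\<le>?D. ?f d)"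
      by (rule fls_nth_poly_to_fls_mult) simp
    also have "\<dots> = (\<Sum>d\<in>?S. ?f d)"
      using f0 by (intro sum.mono_neutral_right) (auto split: if_splits)
    finally show ?thesis
      by (auto simp: S residue_def)
  qed
  then show ?thesis
    by (simp add: linear_form_combination fls_nth_sum)
qed

text \<open>Raising the parameter by \<theta> leaves the body at level t unchanged if the fractional
  part of t is at least \<theta>; otherwise it forbids one more index of
  \<open>u \<bullet> x\<close>, namely \<open>m - N\<close> with
  \<open>N = \<lfloor>t\<rfloor>\<close>. That coefficient is the residue at \<open>k\<close> times
  the coefficient of \<open>c k\<close> in degree \<open>N - p k\<close>, so just the case
  \<open>d + p k = N\<close> is excluded: the effect of adding \<theta> to
  \<open>p k\<close>.\<close>

lemma reduced_basis_step:
  assumes red: "reduced_basis n u (real m) (\<lambda>i. real (p i)) X"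
    and "k < n" and res_k: "residue n u m p X k \<noteq> 0"
    and res: "\<And>i. i < n \<Longrightarrow> i \<noteq> k \<Longrightarrow> residue n u m p X i = 0"
    and \<theta>: "0 \<le> \<theta>" "\<theta> \<le> 1"
  shows "reduced_basis n u (real m + \<theta>) (\<lambda>i. real (p i) + (if i = k then \<theta> else 0)) X"
proof -
  have "in_body n u (real m + \<theta>) t (combination n c X) \<longleftrightarrow>
      weighted_degrees_le n (\<lambda>i. real (p i) + (if i = k then \<theta> else 0)) t c" for c t
  proof -
    define N where "N = \<lfloor>t\<rfloor>"
    define x where "x = combination n c X"
    have N: "real_of_int N \<le> t" "t < real_of_int N + 1"
      unfolding N_def by linarith+
    have fl: "\<lfloor>t\<rfloor> = N"
      by (simp add: N_def)
    have body0: "in_body n u (real m) (real_of_int N) x \<longleftrightarrow>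
        weighted_degrees_le n (\<lambda>i. real (p i)) (real_of_int N) c"
      using red by (simp add: reduced_basis_def x_def)
    have wd0: "weighted_degrees_le n (\<lambda>i. real (p i)) (real_of_int N) c \<longleftrightarrow>
        (\<forall>i<n. \<forall>d. poly.coeff (c i) d \<noteq> 0 \<longrightarrow> int d + int (p i) \<le> N)"
    proof -
      have "real d + real (p i) \<le> real_of_int N \<longleftrightarrow> int d + int (p i) \<le> N" for d i
        by linarith
      then show ?thesis
        by (simp add: weighted_degrees_le_def)
    qed
    show ?thesis
    proof (cases "\<theta> \<le> t - real_of_int N")
      case True
      have "\<lceil>real m + \<theta> - t\<rceil> = int m - N" "\<lceil>real m - real_of_int N\<rceil> = int m - N"
        using True N \<theta> by (simp_all add: ceiling_eq_iff)
      then have "in_body n u (real m + \<theta>) t x \<longleftrightarrow> in_body n u (real m) (real_of_int N) x"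
        by (simp add: in_body_floor_iff fl)
      moreover have "real d + (real (p i) + (if i = k then \<theta> else 0)) \<le> t \<longleftrightarrow> int d + int (p i) \<le> N" for i d
        using True N \<theta> by (cases "i = k"; simp only: simp_thms if_True if_False; linarith)
      ultimately show ?thesis
        using body0 wd0 by (simp add: x_def weighted_degrees_le_def)
    next
      case False
      have "\<lceil>real m + \<theta> - t\<rceil> = int m - N + 1" "\<lceil>real m - real_of_int N\<rceil> = int m - N"
        using False N \<theta> by (simp_all add: ceiling_eq_iff)
      moreover have "(\<forall>k. fls_nth (linear_form n u x) k \<noteq> 0 \<longrightarrow> int m - N + 1 \<le> k) \<longleftrightarrow>
          (\<forall>k. fls_nth (linear_form n u x) k \<noteq> 0 \<longrightarrow> int m - N \<le> k) \<and>
          fls_nth (linear_form n u x) (int m - N) = 0"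
        by (smt (verit, best))
      ultimately have "in_body n u (real m + \<theta>) t x \<longleftrightarrow>
          in_body n u (real m) (real_of_int N) x \<and> fls_nth (linear_form n u x) (int m - N) = 0"
        by (auto simp: in_body_floor_iff fl)
      also have "\<dots> \<longleftrightarrow> weighted_degrees_le n (\<lambda>i. real (p i)) (real_of_int N) c \<and>
          (int (p k) \<le> N \<longrightarrow> poly.coeff (c k) (nat (N - int (p k))) = 0)"
      proof -
        have "fls_nth (linear_form n u x) (int m - N) =
            (if int (p k) \<le> N then poly.coeff (c k) (nat (N - int (p k))) * residue n u m p X k else 0)"
          if "weighted_degrees_le n (\<lambda>i. real (p i)) (real_of_int N) c"
        proof -
          let ?f = "\<lambda>i. if int (p i) \<le> N then poly.coeff (c i) (nat (N - int (p i))) * residue n u m p X i else 0"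
          have "sum ?f {..<n} = ?f k + sum ?f ({..<n} - {k})"
            using \<open>k < n\<close> by (intro sum.remove) simp_all
          also have "sum ?f ({..<n} - {k}) = 0"
            by (intro sum.neutral ballI) (simp add: res)
          finally show ?thesis
            by (simp add: x_def fls_nth_linear_form_combination[OF red that])
        qed
        then show ?thesis
          using body0 res_k by auto
      qed
      also have "\<dots> \<longleftrightarrow> weighted_degrees_le n (\<lambda>i. real (p i) + (if i = k then \<theta> else 0)) t c"
      proof -
        have "real d + (real (p i) + (if i = k then \<theta> else 0)) \<le> t \<longleftrightarrow>
            int d + int (p i) \<le> N \<and> (i = k \<longrightarrow> int d + int (p i) \<noteq> N)" for i d
          using False N \<theta> by (cases "i = k"; simp only: simp_thms if_True if_False; linarith)
        moreover have "(int (p k) \<le> N \<longrightarrow> poly.coeff (c k) (nat (N - int (p k))) = 0) \<longleftrightarrow>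
            (\<forall>d. poly.coeff (c k) d \<noteq> 0 \<longrightarrow> int d + int (p k) \<noteq> N)"
          by auto
        ultimately show ?thesis
          using \<open>k < n\<close> unfolding wd0 by (auto simp: weighted_degrees_le_def)
      qed
      finally show ?thesis
        by (simp add: x_def)
    qed
  qed
  then show ?thesis
    using red by (simp add: reduced_basis_def)
qed

section \<open>Changes of reduced basis\<close>

lemma weighted_degrees_le_shear:
  assumes c: "weighted_degrees_le n p t c" and "k < n"
    and M: "\<And>i d. i < n \<Longrightarrow> poly.coeff (M i) d \<noteq> 0 \<Longrightarrow> real d + p k \<le> p i"
  shows "weighted_degrees_le n p t (c(k := c k + (\<Sum>i\<in>{..<n} - {k}. c i * M i)))"
proof -
  have "real d + p k \<le> t"
    if nz: "poly.coeff (c k + (\<Sum>i\<in>{..<n} - {k}. c i * M i)) d \<noteq> 0" for d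
  proof (cases "poly.coeff (c k) d = 0")
    case True
    with nz have "(\<Sum>i\<in>{..<n} - {k}. poly.coeff (c i * M i) d) \<noteq> 0"
      by (simp add: coeff_sum)
    then obtain i where i: "i < n" "poly.coeff (c i * M i) d \<noteq> 0"
      by (meson DiffD1 lessThan_iff sum.neutral)
    then obtain e where e: "e \<le> d" "poly.coeff (c i) e \<noteq> 0" "poly.coeff (M i) (d - e) \<noteq> 0"
      unfolding coeff_mult by (elim sum.not_neutral_contains_not_neutral) auto
    have "real e + p i \<le> t"
      using c i e by (simp add: weighted_degrees_le_def)
    moreover have "real (d - e) + p k \<le> p i"
      using M[OF i(1) e(3)] .
    ultimately show ?thesis
      using e(1) by simp
  next
    case False
    then show ?thesis
      using c \<open>k < n\<close> by (simp add: weighted_degrees_le_def)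
  qed
  then show ?thesis
    using c by (simp add: weighted_degrees_le_def)
qed

text \<open>A nonzero \<open>M i\<close> has degree at most \<open>p i - p k\<close>, so
  \<open>c i * M i\<close> weighs no more at index \<open>k\<close> than \<open>c i\<close> does at
  index \<open>i\<close>. The coordinate change and its inverse therefore both preserve the weighted
  degree bounds.\<close>

lemma reduced_basis_shear:
  assumes red: "reduced_basis n u q p X" and "k < n"
    and M: "\<And>i d. i < n \<Longrightarrow> poly.coeff (M i) d \<noteq> 0 \<Longrightarrow> real d + p k \<le> p i"
  shows "reduced_basis n u q p (\<lambda>i j. if i = k then X k j else X i j - M i * X k j)"
proof -
  let ?X = "\<lambda>i j. if i = k then X k j else X i j - M i * X k j"
  \<comment> \<open>Only the coordinate \<open>k\<close> changes, by a sum that omits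
    \<open>k\<close>, so the factors \<open>s\<close> and \<open>- s\<close> give inverse
    maps.\<close>
  define shear where "shear s c = c(k := c k + (\<Sum>i\<in>{..<n} - {k}. c i * (s * M i)))"
    for s :: "'a poly" and c :: "nat \<Rightarrow> 'a poly"
  have comb: "combination n c ?X = combination n (shear (- 1) c) X" for c
  proof
    fix j
    have "combination n c ?X j = c k * X k j + (\<Sum>i\<in>{..<n} - {k}. c i * (X i j - M i * X k j))"
      unfolding combination_def using \<open>k < n\<close> by (subst sum.remove[of _ k]) auto
    also have "\<dots> = (c k + (\<Sum>i\<in>{..<n} - {k}. c i * (- 1 * M i))) * X k j + (\<Sum>i\<in>{..<n} - {k}. c i * X i j)"
      by (simp add: algebra_simps sum_subtractf sum_distrib_left sum_negf)
    also have "\<dots> = combination n (shear (- 1) c) X j"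
      unfolding combination_def shear_def using \<open>k < n\<close> by (subst sum.remove[of _ k]) auto
    finally show "combination n c ?X j = combination n (shear (- 1) c) X j" .
  qed
  have inv: "shear (- s) (shear s c) = c" for s c
    by (auto simp: shear_def fun_eq_iff sum_negf)
  have wd: "weighted_degrees_le n p t (shear s c)" if "weighted_degrees_le n p t c" "s = 1 \<or> s = - 1" for s c t
    unfolding shear_def using that M \<open>k < n\<close> by (intro weighted_degrees_le_shear) auto
  have iff: "weighted_degrees_le n p t (shear (- 1) c) \<longleftrightarrow> weighted_degrees_le n p t c" for c t
    using wd[of t c "- 1"] wd[of t "shear (- 1) c" 1] inv[of "- 1" c] by auto
  have "\<exists>c. \<forall>j<n. x j = combination n c ?X j" for x
  proof -
    obtain c where "\<forall>j<n. x j = combination n c X j"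
      using red unfolding reduced_basis_def by blast
    then have "\<forall>j<n. x j = combination n (shear 1 c) ?X j"
      unfolding comb using inv[of 1 c] by simp
    then show ?thesis
      by blast
  qed
  moreover have "in_body n u q t (combination n c ?X) \<longleftrightarrow> weighted_degrees_le n p t c" for c t
    unfolding comb using red iff by (simp add: reduced_basis_def)
  ultimately show ?thesis
    by (simp add: reduced_basis_def)
qed

text \<open>Multiplication by T^(p i - p k) moves index \<open>m - p k\<close> of
  \<open>u \<bullet> X k\<close> to index \<open>m - p i\<close>, where scaling by
  \<open>r i / r k\<close> makes it cancel \<open>r i\<close>. Minimality of \<open>p k\<close>
  bounds the multiplier's degree as a shear requires.\<close>

lemma reduced_basis_clear:
  assumes red: "reduced_basis n u (real m) (\<lambda>i. real (p i)) X"
    and "k < n" and res_k: "residue n u m p X k \<noteq> 0"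
    and min: "\<And>i. i < n \<Longrightarrow> residue n u m p X i \<noteq> 0 \<Longrightarrow> p k \<le> p i"
  defines "r \<equiv> residue n u m p X"
  defines "X' \<equiv> \<lambda>i j. if i = k then X k j else X i j - Polynomial.monom (r i / r k) (p i - p k) * X k j"
  shows "reduced_basis n u (real m) (\<lambda>i. real (p i)) X'"
    and "\<And>i. i < n \<Longrightarrow> residue n u m p X' i = (if i = k then r k else 0)"
proof -
  show "reduced_basis n u (real m) (\<lambda>i. real (p i)) X'"
    unfolding X'_def using red \<open>k < n\<close>
    by (rule reduced_basis_shear) (use min in \<open>auto simp: r_def split: if_splits\<close>)
  show "residue n u m p X' i = (if i = k then r k else 0)" if "i < n" for i
  proof (cases "i = k")
    case True
    then show ?thesis
      by (simp add: residue_def X'_def r_def)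
  next
    case False
    then have "linear_form n u (X' i) = linear_form n u (X i) -
        poly_to_fls (Polynomial.monom (r i / r k) (p i - p k)) * linear_form n u (X k)"
      by (simp add: linear_form_def X'_def poly_to_fls_diff poly_to_fls_mult right_diff_distrib
          mult.left_commute sum_subtractf sum_distrib_left)
    then have "residue n u m p X' i =
        r i - r i / r k * fls_nth (linear_form n u (X k)) (int m - int (p i) + int (p i - p k))"
      by (simp add: residue_def r_def fls_nth_monom_mult)
    also have "\<dots> = 0"
    \<comment> \<open>If \<open>r i = 0\<close>, the exponent may be a truncated difference, but the
      monomial is zero.\<close>
    proof (cases "r i = 0")
      case False
      then have "int m - int (p i) + int (p i - p k) = int m - int (p k)"
        using min[OF \<open>i < n\<close>] by (simp add: r_def)
      then show ?thesis
        using res_k by (simp add: r_def residue_def)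
    qed simp
    finally show ?thesis
      using False by simp
  qed
qed

lemma reduced_basis_transpose:
  assumes red: "reduced_basis n u q p X" and "a < n" "b < n" "p a = p b"
  shows "reduced_basis n u q p (X \<circ> transpose a b)"
proof -
  let ?\<tau> = "transpose a b"
  have \<tau>: "?\<tau> permutes {..<n}"
    using assms by (intro permutes_swap_id) auto
  have comb: "combination n c (X \<circ> ?\<tau>) = combination n (c \<circ> ?\<tau>) X" for c
    using sum.permute[OF \<tau>, of "\<lambda>i. c i * X (?\<tau> i) _"] by (auto simp: combination_def o_def)
  have [simp]: "p (?\<tau> i) = p i" for i
    using \<open>p a = p b\<close> by (metis transpose_apply_first transpose_apply_other transpose_apply_second)
  have wd: "weighted_degrees_le n p t (c \<circ> ?\<tau>)" if "weighted_degrees_le n p t c" for c t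
    unfolding weighted_degrees_le_def
  proof (intro allI impI)
    fix i d assume "i < n" "poly.coeff ((c \<circ> ?\<tau>) i) d \<noteq> 0"
    moreover from \<open>i < n\<close> have "?\<tau> i < n"
      using permutes_in_image[OF \<tau>, of i] by simp
    ultimately have "real d + p (?\<tau> i) \<le> t"
      using that unfolding weighted_degrees_le_def by (metis comp_apply)
    then show "real d + p i \<le> t"
      by simp
  qed
  have iff: "weighted_degrees_le n p t (c \<circ> ?\<tau>) \<longleftrightarrow> weighted_degrees_le n p t c" for c t
    using wd[of t c] wd[of t "c \<circ> ?\<tau>"] by (auto simp: comp_assoc)
  have "\<exists>c. \<forall>j<n. x j = combination n (c \<circ> ?\<tau>) X j" for x
  proof -
    obtain c where "\<forall>j<n. x j = combination n c X j"
      using red unfolding reduced_basis_def by blast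
    then show ?thesis
      by (intro exI[of _ "c \<circ> ?\<tau>"]) (simp add: comp_assoc)
  qed
  moreover have "in_body n u q t (combination n (c \<circ> ?\<tau>) X) \<longleftrightarrow> weighted_degrees_le n p t c" for c t
    using red iff[of t c] unfolding reduced_basis_def by metis
  ultimately show ?thesis
    unfolding reduced_basis_def comb by simp
qed

lemma residue_transpose:
  assumes "p a = p b"
  shows "residue n u m p (X \<circ> transpose a b) i = residue n u m p X (transpose a b i)"
proof -
  have "p (transpose a b i) = p i"
    using assms by (metis transpose_apply_first transpose_apply_other transpose_apply_second)
  then show ?thesis
    by (simp add: residue_def)
qed


section \<open>Discrete systems\<close>

text \<open>
  Here \<open>p m\<close> is the value of the system at the integer \<open>m\<close>, and \<open>k m\<close> is the index of the component
  that grows on \<open>[m, m + 1]\<close>. The last clause is (S3) at \<open>m + 1\<close>.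
\<close>

definition discrete_system :: "nat \<Rightarrow> (nat \<Rightarrow> nat \<Rightarrow> nat) \<Rightarrow> (nat \<Rightarrow> nat) \<Rightarrow> bool" where
  "discrete_system n p k \<longleftrightarrow>
     (\<forall>i<n. p 0 i = 0) \<and>
     (\<forall>m. k m < n \<and>
        (\<forall>i<n. p (Suc m) i = p m i + (if i = k m then 1 else 0)) \<and>
        (\<forall>i j. i \<le> j \<and> j < n \<longrightarrow> p m i \<le> p m j) \<and>
        (k m < k (Suc m) \<longrightarrow> p (Suc m) (k (Suc m)) = p (Suc m) (k m)))"

definition interpolation :: "nat \<Rightarrow> (nat \<Rightarrow> nat \<Rightarrow> nat) \<Rightarrow> (nat \<Rightarrow> nat) \<Rightarrow> real \<Rightarrow> real vec" where
  "interpolation n p k =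
     (\<lambda>q\<in>{0..}. vec n (\<lambda>i. real (p (nat \<lfloor>q\<rfloor>) i) + (if i = k (nat \<lfloor>q\<rfloor>) then frac q else 0)))"

section \<open>From a vector of norm 1 to a discrete system\<close>

lemma max_norm_eq_1_iff:
  fixes u :: "'a::field fls vec"
  assumes "0 < n" "u \<in> carrier_vec n"
  shows "max_norm u = 1 \<longleftrightarrow>
    (\<forall>j<n. \<forall>k<0. fls_nth (vec_index u j) k = 0) \<and> (\<exists>j<n. fls_nth (vec_index u j) 0 \<noteq> 0)"
proof -
  have le: "fls_abs x \<le> 1 \<longleftrightarrow> (\<forall>k<0. fls_nth x k = 0)" for x :: "'a fls"
    using fls_abs_le_exp_iff[of x 0] by (auto simp: not_less[symmetric])
  have eq: "fls_abs x = 1 \<longleftrightarrow> fls_nth x 0 \<noteq> 0" if "\<forall>k<0. fls_nth x k = 0" for x :: "'a fls"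
  proof (cases "x = 0")
    case False
    then have "0 \<le> fls_subdegree x"
      using that nth_fls_subdegree_nonzero[OF False] by (meson not_less)
    then have "fls_nth x 0 \<noteq> 0 \<longleftrightarrow> fls_subdegree x = 0"
      using nth_fls_subdegree_nonzero[OF False] fls_subdegree_leI[of x 0] by (metis order_antisym)
    then show ?thesis
      using False by (simp add: fls_abs_def)
  qed (simp add: fls_abs_def)
  let ?S = "(\<lambda>i. fls_abs (vec_index u i)) ` {..<n}"
  have S: "finite ?S" "?S \<noteq> {}" "max_norm u = Max ?S"
    using assms by (auto simp: max_norm_def lessThan_empty_iff)
  have "max_norm u = 1 \<longleftrightarrow> (\<forall>j<n. fls_abs (vec_index u j) \<le> 1) \<and> (\<exists>j<n. fls_abs (vec_index u j) = 1)"
    unfolding S(3) by (subst Max_eq_iff[OF S(1,2)]) fastforce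
  then show ?thesis
    unfolding le using eq by metis
qed

text \<open>If \<open>k\<close> is the last index with its value, any later value is an integer at
  least \<open>p k + 1\<close>, which leaves room for a growth by \<theta> \<le> 1.\<close>

lemma sorted_increment_last:
  fixes p :: "nat \<Rightarrow> nat"
  assumes sorted: "\<And>i j. i \<le> j \<Longrightarrow> j < n \<Longrightarrow> p i \<le> p j"
    and last: "\<And>i. k < i \<Longrightarrow> i < n \<Longrightarrow> p i \<noteq> p k"
    and "i \<le> j" "j < n" "0 \<le> \<theta>" "\<theta> \<le> 1"
  shows "real (p i) + (if i = k then \<theta> else 0) \<le> real (p j) + (if j = k then \<theta> else 0)"
proof (cases "i = k \<and> j \<noteq> k")
  case True
  with assms have "p i < p j"
    by (metis le_neq_implies_less)
  with \<open>\<theta> \<le> 1\<close> True show ?thesis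
    by simp
qed (use assms in \<open>auto intro: add_increasing2\<close>)

text \<open>
  If all residues vanished, the unit vectors would still have gauge at most \<open>m\<close> at parameter \<open>m + 1\<close>,
  that is \<open>|u\<^sub>j| < 1\<close> for all \<open>j\<close>.
\<close>

lemma exists_nonzero_residue:
  assumes red: "reduced_basis n u (real m) (\<lambda>i. real (p i)) X"
    and u: "\<And>j k. j < n \<Longrightarrow> k < 0 \<Longrightarrow> fls_nth (u j) k = 0" "j0 < n" "fls_nth (u j0) 0 \<noteq> 0"
  shows "\<exists>i<n. residue n u m p X i \<noteq> 0"
proof (rule ccontr)
  assume neg: "\<not> (\<exists>i<n. residue n u m p X i \<noteq> 0)"
  define x :: "nat \<Rightarrow> 'a poly" where "x = (\<lambda>j. if j = j0 then 1 else 0)"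
  have lf: "linear_form n u x = u j0"
    using \<open>j0 < n\<close> by (simp add: linear_form_def x_def poly_to_fls_1 if_distrib[of poly_to_fls]
        if_distrib[of "\<lambda>y. _ * y"] cong: if_cong)
  obtain c where c: "\<forall>j<n. x j = combination n c X j"
    using red unfolding reduced_basis_def by blast
  then have lf': "linear_form n u (combination n c X) = u j0"
    unfolding lf[symmetric] by (simp add: linear_form_def)
  have "in_body n u (real m) (real m) x"
    unfolding in_body_def lf
    using u(1)[OF \<open>j0 < n\<close>] by (auto simp: x_def not_less[symmetric] split: if_splits)
  then have "in_body n u (real m) (real m) (combination n c X)"
    using c lf lf' by (simp add: in_body_def)
  then have "weighted_degrees_le n (\<lambda>i. real (p i)) (real_of_int (int m)) c"
    using red by (simp add: reduced_basis_def)
  from fls_nth_linear_form_combination[OF red this] show False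
    using neg u(3) by (simp add: lf' sum.neutral)
qed

text \<open>The two final conclusions serve (S3): the nonzero residue at \<open>k\<close> survives
  to the next step, where minimality bounds the next growing component by this one.\<close>

lemma exists_reduced_basis_step:
  fixes p :: "nat \<Rightarrow> nat"
  assumes red: "reduced_basis n u (real m) (\<lambda>i. real (p i)) X"
    and u: "\<And>j k. j < n \<Longrightarrow> k < 0 \<Longrightarrow> fls_nth (u j) k = 0" "j0 < n" "fls_nth (u j0) 0 \<noteq> 0"
    and sorted: "\<And>i j. i \<le> j \<Longrightarrow> j < n \<Longrightarrow> p i \<le> p j"
  obtains k X' where "k < n"
    "\<And>i. k < i \<Longrightarrow> i < n \<Longrightarrow> p i \<noteq> p k"
    "\<And>\<theta>. 0 \<le> \<theta> \<Longrightarrow> \<theta> \<le> 1 \<Longrightarrow>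
       reduced_basis n u (real m + \<theta>) (\<lambda>i. real (p i) + (if i = k then \<theta> else 0)) X'"
    "residue n u m p X' k \<noteq> 0"
    "\<And>i. i < n \<Longrightarrow> residue n u m p X i \<noteq> 0 \<Longrightarrow> p k \<le> p i"
proof -
  define I where "I = {i. i < n \<and> residue n u m p X i \<noteq> 0}"
  have "\<exists>i. i \<in> I"
    using exists_nonzero_residue[OF red u] by (auto simp: I_def)
  then obtain k0 where k0: "k0 \<in> I" "\<And>i. i \<in> I \<Longrightarrow> p k0 \<le> p i"
    using ex_has_least_nat[of "\<lambda>i. i \<in> I" _ p] by blast
  \<comment> \<open>Among the indices with the minimal value, only the last can grow without
    breaking the order. The transposition below moves the vector at \<open>k0\<close> there.\<close>
  define k where "k = Max {i. i < n \<and> p i = p k0}"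
  have "k \<in> {i. i < n \<and> p i = p k0}"
    unfolding k_def by (rule Max_in) (use k0 in \<open>auto simp: I_def\<close>)
  then have k: "k < n" "p k = p k0"
    by auto
  have last: "p i \<noteq> p k" if "k < i" "i < n" for i
  proof
    assume "p i = p k"
    with k that have "i \<le> k"
      unfolding k_def by (intro Max_ge) auto
    with that show False
      by simp
  qed
  define Y where "Y = X \<circ> transpose k0 k"
  have redY: "reduced_basis n u (real m) (\<lambda>i. real (p i)) Y"
    unfolding Y_def using k0 k by (intro reduced_basis_transpose[OF red]) (auto simp: I_def)
  have resY: "residue n u m p Y i = residue n u m p X (transpose k0 k i)" for i
    unfolding Y_def using k by (intro residue_transpose) simp
  have resY_k: "residue n u m p Y k \<noteq> 0"
    using k0 by (simp add: resY I_def)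
  have min: "p k \<le> p i" if "i < n" "residue n u m p Y i \<noteq> 0" for i
  proof -
    have "transpose k0 k i \<in> I"
      using that k0 k by (auto simp: resY I_def transpose_def)
    with k0(2) k show ?thesis
      by (cases "i = k0 \<or> i = k") (auto simp: transpose_def split: if_splits)
  qed
  define X' where "X' = (\<lambda>i j. if i = k then Y k j else Y i j -
      Polynomial.monom (residue n u m p Y i / residue n u m p Y k) (p i - p k) * Y k j)"
  have redX': "reduced_basis n u (real m) (\<lambda>i. real (p i)) X'"
    using reduced_basis_clear(1)[OF redY k(1) resY_k min] by (simp add: X'_def)
  have resX': "residue n u m p X' i = (if i = k then residue n u m p Y k else 0)" if "i < n" for i
    using reduced_basis_clear(2)[OF redY k(1) resY_k _ that] min unfolding X'_def by blast
  have res_k: "residue n u m p X' k \<noteq> 0"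
    using resX'[OF k(1)] resY_k by simp
  show thesis
  proof (rule that[of k X'])
    show "reduced_basis n u (real m + \<theta>) (\<lambda>i. real (p i) + (if i = k then \<theta> else 0)) X'"
      if "0 \<le> \<theta>" "\<theta> \<le> 1" for \<theta>
      using reduced_basis_step[OF redX' k(1) res_k _ that] resX' by simp
    show "p k \<le> p i" if "i < n" "residue n u m p X i \<noteq> 0" for i
      using k0(2)[of i] k that by (simp add: I_def)
  qed (use k last res_k in auto)
qed

theorem exists_discrete_system:
  fixes u :: "nat \<Rightarrow> 'a::field fls"
  assumes u: "\<And>j k. j < n \<Longrightarrow> k < 0 \<Longrightarrow> fls_nth (u j) k = 0" "j0 < n" "fls_nth (u j0) 0 \<noteq> 0"
  obtains p k where "discrete_system n p k"
    "\<And>m \<theta>. 0 \<le> \<theta> \<Longrightarrow> \<theta> \<le> 1 \<Longrightarrow>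
       \<exists>X. reduced_basis n u (real m + \<theta>) (\<lambda>i. real (p m i) + (if i = k m then \<theta> else 0)) X"
proof -
  define inc :: "(nat \<Rightarrow> nat) \<Rightarrow> nat \<Rightarrow> nat \<Rightarrow> nat" where "inc p k = (\<lambda>i. p i + (if i = k then 1 else 0))" for p k
  \<comment> \<open>A state holds the values, a reduced basis and the index \<open>l\<close> that
    grew last; at \<open>m = 0\<close> nothing has grown and \<open>l\<close> is
    unconstrained.\<close>
  define P where "P m s \<longleftrightarrow> (case s of (p, X, l) \<Rightarrow>
      reduced_basis n u (real m) (\<lambda>i. real (p i)) X \<and> (\<forall>i j. i \<le> j \<and> j < n \<longrightarrow> p i \<le> p j) \<and>
      (m = 0 \<longrightarrow> p = (\<lambda>_. 0)) \<and> (0 < m \<longrightarrow> l < n \<and> residue n u m p X l \<noteq> 0))"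
    for m :: nat and s :: "(nat \<Rightarrow> nat) \<times> (nat \<Rightarrow> nat \<Rightarrow> 'a poly) \<times> nat"
  define Q where "Q m s s' \<longleftrightarrow> (case (s, s') of ((p, X, l), (p', X', k)) \<Rightarrow> k < n \<and> p' = inc p k \<and>
      (0 < m \<and> l < k \<longrightarrow> p k = p l) \<and>
      (\<forall>\<theta>. 0 \<le> \<theta> \<and> \<theta> \<le> 1 \<longrightarrow>
        reduced_basis n u (real m + \<theta>) (\<lambda>i. real (p i) + (if i = k then \<theta> else 0)) X'))"
    for m :: nat and s s' :: "(nat \<Rightarrow> nat) \<times> (nat \<Rightarrow> nat \<Rightarrow> 'a poly) \<times> nat"
  have "\<exists>f. \<forall>m. P m (f m) \<and> Q m (f m) (f (Suc m))"
  proof (rule dependent_nat_choice)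
    show "\<exists>s. P 0 s"
      using reduced_basis_unit[of n u] u(1) by (auto simp: P_def intro!: exI[of _ "\<lambda>_. 0"])
  next
    fix s m assume "P m s"
    then obtain p X l where s: "s = (p, X, l)" and red: "reduced_basis n u (real m) (\<lambda>i. real (p i)) X"
      and sorted: "\<And>i j. i \<le> j \<Longrightarrow> j < n \<Longrightarrow> p i \<le> p j"
      and l: "0 < m \<Longrightarrow> l < n \<and> residue n u m p X l \<noteq> 0"
      by (auto simp: P_def)
    obtain k X' where k: "k < n" "\<And>i. k < i \<Longrightarrow> i < n \<Longrightarrow> p i \<noteq> p k"
      and red': "\<And>\<theta>. 0 \<le> \<theta> \<Longrightarrow> \<theta> \<le> 1 \<Longrightarrow>
         reduced_basis n u (real m + \<theta>) (\<lambda>i. real (p i) + (if i = k then \<theta> else 0)) X'"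
      and res: "residue n u m p X' k \<noteq> 0"
      and min: "\<And>i. i < n \<Longrightarrow> residue n u m p X i \<noteq> 0 \<Longrightarrow> p k \<le> p i"
      using exists_reduced_basis_step[OF red u sorted] by blast
    have "(\<lambda>i. real (p i) + (if i = k then 1 else 0)) = (\<lambda>i. real (inc p k i))"
      by (auto simp: inc_def)
    then have "reduced_basis n u (real (Suc m)) (\<lambda>i. real (inc p k i)) X'"
      using red'[of 1] by (simp add: add.commute)
    \<comment> \<open>\<open>m\<close> and the value at \<open>k\<close> both increase by one, so
      the residue is read at the same index as before.\<close>
    moreover have "residue n u (Suc m) (inc p k) X' k \<noteq> 0"
      using res by (simp add: residue_def inc_def)
    moreover have "inc p k i \<le> inc p k j" if "i \<le> j" "j < n" for i j
      using sorted_increment_last[of n p k i j 1, OF sorted k(2) that]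
      by (simp add: inc_def split: if_splits)
    ultimately have "P (Suc m) (inc p k, X', k)"
      using k(1) by (simp add: P_def)
    \<comment> \<open>The residue at \<open>l\<close> is nonzero, so minimality gives
      \<open>p k \<le> p l\<close>; for \<open>l < k\<close> the order gives the converse.\<close>
    moreover have "p k = p l" if "0 < m" "l < k"
      using min[of l] l sorted[of l k] k(1) that by auto
    then have "Q m s (inc p k, X', k)"
      using k(1) red' by (simp add: Q_def s)
    ultimately show "\<exists>s'. P (Suc m) s' \<and> Q m s s'"
      by blast
  qed
  then obtain f where f: "\<And>m. P m (f m)" "\<And>m. Q m (f m) (f (Suc m))"
    by blast
  define p where "p m = fst (f m)" for m
  define X where "X m = fst (snd (f m))" for m
  define k where "k m = snd (snd (f (Suc m)))" for m
  have f_eq: "f m = (p m, X m, snd (snd (f m)))" for m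
    by (simp add: p_def X_def)
  have P: "\<forall>i j. i \<le> j \<and> j < n \<longrightarrow> p m i \<le> p m j" "p 0 = (\<lambda>_. 0)" for m
    using f(1)[of m] f(1)[of 0] by (auto simp: P_def p_def split: prod.splits)
  have Q: "k m < n" "p (Suc m) = inc (p m) (k m)"
    "0 \<le> \<theta> \<Longrightarrow> \<theta> \<le> 1 \<Longrightarrow> reduced_basis n u (real m + \<theta>)
       (\<lambda>i. real (p m i) + (if i = k m then \<theta> else 0)) (X (Suc m))" for m \<theta>
    using f(2)[of m] by (auto simp: Q_def p_def X_def k_def split: prod.splits)
  have Q': "p (Suc m) (k (Suc m)) = p (Suc m) (k m)" if "k m < k (Suc m)" for m
    using f(2)[of "Suc m"] that by (auto simp: Q_def p_def X_def k_def split: prod.splits)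
  have "discrete_system n p k"
    unfolding discrete_system_def using P Q Q' by (auto simp: inc_def)
  with Q(3) show thesis
    by (intro that) blast+
qed


section \<open>Integral systems as interpolations\<close>

lemma interpolation_at:
  assumes "discrete_system n p k" "0 \<le> \<theta>" "\<theta> \<le> 1"
  shows "interpolation n p k (real m + \<theta>) = vec n (\<lambda>i. real (p m i) + (if i = k m then \<theta> else 0))"
proof (cases "\<theta> = 1")
  case True
  have "nat \<lfloor>real m + 1\<rfloor> = Suc m" "frac (real m + 1) = 0"
    by (simp_all add: frac_def nat_add_distrib)
  then show ?thesis
    using assms True by (auto simp: interpolation_def discrete_system_def)
next
  case False
  with assms have "\<lfloor>real m + \<theta>\<rfloor> = int m"
    by (simp add: floor_eq_iff)
  then show ?thesis
    using assms by (auto simp: interpolation_def frac_def)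
qed

lemma discrete_systemD:
  assumes "discrete_system n p k"
  shows "i < n \<Longrightarrow> p 0 i = 0"
    and "k m < n"
    and "i < n \<Longrightarrow> p (Suc m) i = p m i + (if i = k m then 1 else 0)"
    and "i \<le> j \<Longrightarrow> j < n \<Longrightarrow> p m i \<le> p m j"
    and "k m < k (Suc m) \<Longrightarrow> p (Suc m) (k (Suc m)) = p (Suc m) (k m)"
  using assms unfolding discrete_system_def by blast+

lemma discrete_system_last:
  assumes "discrete_system n p k" "k m < i" "i < n"
  shows "p m i \<noteq> p m (k m)"
proof
  assume "p m i = p m (k m)"
  moreover have "p (Suc m) (k m) \<le> p (Suc m) i"
    using discrete_systemD(4)[OF assms(1)] assms by simp
  moreover have "p (Suc m) (k m) = p m (k m) + 1" "p (Suc m) i = p m i"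
    using discrete_systemD(2,3)[OF assms(1)] assms by simp_all
  ultimately show False
    by simp
qed

lemma discrete_system_sorted:
  assumes "discrete_system n p k" "i \<le> j" "j < n" "0 \<le> \<theta>" "\<theta> \<le> 1"
  shows "real (p m i) + (if i = k m then \<theta> else 0) \<le> real (p m j) + (if j = k m then \<theta> else 0)"
  by (rule sorted_increment_last[where n = n])
    (use assms discrete_system_last[of n p k m] discrete_systemD(4) in auto)

lemma discrete_system_sum:
  assumes "discrete_system n p k"
  shows "(\<Sum>i<n. p m i) = m"
proof (induction m)
  case 0
  then show ?case
    using assms by (simp add: discrete_system_def)
next
  case (Suc m)
  have "(\<Sum>i<n. p (Suc m) i) = (\<Sum>i<n. p m i + (if i = k m then 1 else 0))"
    using assms by (intro sum.cong) (auto simp: discrete_system_def)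
  also have "\<dots> = Suc m"
    using Suc assms by (simp add: sum.distrib discrete_system_def)
  finally show ?case .
qed

text \<open>Inside a unit interval the two directions of (S2) coincide. At a positive integer they
  belong to the two adjacent intervals, and the order extends the equality of the two extreme
  components to those between.\<close>

lemma n_system_interpolation:
  assumes d: "discrete_system n p k"
  shows "n_system n (interpolation n p k)"
proof -
  let ?P = "interpolation n p k"
  have k: "k m < n" for m
    using d by (simp add: discrete_system_def)
  have line: "?P t = ?P s + (t - s) \<cdot>\<^sub>v unit_vec n (k m)"
    if "real m \<le> s" "s \<le> real m + 1" "real m \<le> t" "t \<le> real m + 1" for m s t
  proof -
    have "?P (real m + (s - real m)) = vec n (\<lambda>i. real (p m i) + (if i = k m then s - real m else 0))"
      "?P (real m + (t - real m)) = vec n (\<lambda>i. real (p m i) + (if i = k m then t - real m else 0))"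
      by (rule interpolation_at[OF d]; use that in simp)+
    then show ?thesis
      using k[of m] by (intro eq_vecI) auto
  qed
  show ?thesis
    unfolding n_system_def
  proof (intro conjI allI impI)
    show "?P \<in> {0..} \<rightarrow>\<^sub>E carrier_vec n"
      by (auto simp: interpolation_def)
  next
    fix q :: real assume "0 \<le> q"
    define m where "m = nat \<lfloor>q\<rfloor>"
    define \<theta> where "\<theta> = q - real m"
    have m: "real m \<le> q" "q < real m + 1"
      using \<open>0 \<le> q\<close> unfolding m_def by linarith+
    then have \<theta>: "0 \<le> \<theta>" "\<theta> \<le> 1" "q = real m + \<theta>"
      by (simp_all add: \<theta>_def)
    have Pq: "?P q = vec n (\<lambda>i. real (p m i) + (if i = k m then \<theta> else 0))"
      unfolding \<theta>(3) by (rule interpolation_at[OF d \<theta>(1,2)])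
    show "0 \<le> vec_index (?P q) i" if "i < n" for i
      unfolding Pq using that \<theta>(1) by simp
    show "vec_index (?P q) i \<le> vec_index (?P q) j" if "i \<le> j \<and> j < n" for i j
      using discrete_system_sorted[OF d _ _ \<theta>(1,2), of i j m] that by (auto simp: Pq)
    have "(\<Sum>i<n. vec_index (?P q) i) = real (\<Sum>i<n. p m i) + \<theta>"
      using k[of m] by (simp add: Pq sum.distrib)
    then show "(\<Sum>i<n. vec_index (?P q) i) = q"
      by (simp add: discrete_system_sum[OF d] \<theta>(3))
    show "\<exists>\<epsilon>>0. \<exists>k<n. \<exists>l<n.
        (\<forall>t. max 0 (q - \<epsilon>) \<le> t \<and> t \<le> q \<longrightarrow> ?P t = ?P q + (t - q) \<cdot>\<^sub>v unit_vec n l) \<and>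
        (\<forall>t. q \<le> t \<and> t \<le> q + \<epsilon> \<longrightarrow> ?P t = ?P q + (t - q) \<cdot>\<^sub>v unit_vec n k) \<and>
        (q > 0 \<and> k > l \<longrightarrow> (\<forall>i. l \<le> i \<and> i \<le> k \<longrightarrow> vec_index (?P q) i = vec_index (?P q) l))"
    proof (cases "\<theta> = 0")
      case False
      show ?thesis
      proof (rule exI[of _ "min \<theta> (1 - \<theta>)"], intro conjI exI[of _ "k m"])
        show "0 < min \<theta> (1 - \<theta>)"
          using False \<theta> m by auto
        show "\<forall>t. max 0 (q - min \<theta> (1 - \<theta>)) \<le> t \<and> t \<le> q \<longrightarrow> ?P t = ?P q + (t - q) \<cdot>\<^sub>v unit_vec n (k m)"
          "\<forall>t. q \<le> t \<and> t \<le> q + min \<theta> (1 - \<theta>) \<longrightarrow> ?P t = ?P q + (t - q) \<cdot>\<^sub>v unit_vec n (k m)"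
          using \<theta> by (auto intro!: line)
      qed (use k in auto)
    next
      case True
      then have q: "q = real m"
        by (simp add: \<theta>)
      have right: "\<forall>t. q \<le> t \<and> t \<le> q + 1 \<longrightarrow> ?P t = ?P q + (t - q) \<cdot>\<^sub>v unit_vec n (k m)"
        using q by (auto intro!: line)
      show ?thesis
      proof (cases m)
        \<comment> \<open>At \<open>q = 0\<close> the left interval is a single point, so
          \<open>k m\<close> can serve as the left direction as well.\<close>
        case 0
        then have "\<forall>t. max 0 (q - 1) \<le> t \<and> t \<le> q \<longrightarrow> ?P t = ?P q + (t - q) \<cdot>\<^sub>v unit_vec n (k m)"
          using q by (intro allI impI line) auto
        moreover have "\<not> q > 0"
          using q 0 by simp
        moreover have "(0 :: real) < 1"
          by simp
        ultimately show ?thesis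
          using right k by blast
      next
        case (Suc m')
        have left: "\<forall>t. max 0 (q - 1) \<le> t \<and> t \<le> q \<longrightarrow> ?P t = ?P q + (t - q) \<cdot>\<^sub>v unit_vec n (k m')"
          using q Suc by (auto intro!: line)
        have "vec_index (?P q) i = vec_index (?P q) (k m')"
          if "k m' < k m" "k m' \<le> i" "i \<le> k m" for i
        proof -
          have "p m (k m) = p m (k m')"
            using discrete_systemD(5)[OF d, of m'] that(1) unfolding Suc by blast
          moreover have "p m (k m') \<le> p m i" "p m i \<le> p m (k m)"
            using discrete_systemD(4)[OF d] that k[of m] by simp_all
          ultimately show ?thesis
            using that k[of m] True by (simp add: Pq)
        qed
        then have "q > 0 \<and> k m > k m' \<longrightarrow> (\<forall>i. k m' \<le> i \<and> i \<le> k m \<longrightarrow> vec_index (?P q) i = vec_index (?P q) (k m'))"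
          by blast
        moreover have "(0 :: real) < 1"
          by simp
        ultimately show ?thesis
          using left right k by blast
      qed
    qed
  qed
qed

lemma interpolation_integral:
  assumes "discrete_system n p k" "i < n"
  shows "vec_index (interpolation n p k (real m)) i \<in> \<int>"
  using interpolation_at[OF assms(1), of 0 m] assms(2) by simp

section \<open>From integral n-systems to discrete systems\<close>

lemma n_system_local:
  assumes "n_system n P" "0 \<le> q"
  obtains \<epsilon> k l where "0 < \<epsilon>" "k < n" "l < n"
    "\<forall>t. max 0 (q - \<epsilon>) \<le> t \<and> t \<le> q \<longrightarrow> P t = P q + (t - q) \<cdot>\<^sub>v unit_vec n l"
    "\<forall>t. q \<le> t \<and> t \<le> q + \<epsilon> \<longrightarrow> P t = P q + (t - q) \<cdot>\<^sub>v unit_vec n k"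
    "0 < q \<and> l < k \<longrightarrow> (\<forall>i. l \<le> i \<and> i \<le> k \<longrightarrow> vec_index (P q) i = vec_index (P q) l)"
  using assms(1)[unfolded n_system_def, THEN conjunct2, THEN spec[of _ q], THEN mp, OF assms(2),
    THEN conjunct2, THEN conjunct2, THEN conjunct2]
  by (elim exE conjE)

text \<open>(S2) gives monotonicity around each point, where the directions on the two sides may
  differ; bisection makes it global.\<close>

lemma n_system_mono:
  assumes "n_system n P" "i < n" "0 \<le> a" "a \<le> b"
  shows "vec_index (P a) i \<le> vec_index (P b) i"
proof -
  \<comment> \<open>The guard \<open>0 \<le> a\<close> belongs to the bisected predicate, because
    neighbourhoods of a point near 0 reach negative arguments.\<close>
  have "0 \<le> a \<longrightarrow> vec_index (P a) i \<le> vec_index (P b) i"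
    using \<open>a \<le> b\<close>
  proof (rule Bolzano)
    fix x assume "a \<le> x"
    with \<open>0 \<le> a\<close> have "0 \<le> x"
      by simp
    obtain \<epsilon> k l where "0 < \<epsilon>" "k < n" "l < n"
      and left: "\<forall>t. max 0 (x - \<epsilon>) \<le> t \<and> t \<le> x \<longrightarrow> P t = P x + (t - x) \<cdot>\<^sub>v unit_vec n l"
      and right: "\<forall>t. x \<le> t \<and> t \<le> x + \<epsilon> \<longrightarrow> P t = P x + (t - x) \<cdot>\<^sub>v unit_vec n k"
      by (rule n_system_local[OF assms(1) \<open>0 \<le> x\<close>])
    have Px: "P x \<in> carrier_vec n"
      using assms(1) \<open>0 \<le> x\<close> by (auto simp: n_system_def)
    have "vec_index (P s) i \<le> vec_index (P t) i" if "s \<le> x" "x \<le> t" "t - s < \<epsilon>" "0 \<le> s" for s t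
    proof -
      have "P s = P x + (s - x) \<cdot>\<^sub>v unit_vec n l" "P t = P x + (t - x) \<cdot>\<^sub>v unit_vec n k"
        using that by (auto intro!: left[THEN spec, THEN mp] right[THEN spec, THEN mp])
      then show ?thesis
        using Px \<open>i < n\<close> that by (simp add: unit_vec_def)
    qed
    with \<open>0 < \<epsilon>\<close> show "\<exists>d>0. \<forall>s t. s \<le> x \<and> x \<le> t \<and> t - s < d \<longrightarrow> 0 \<le> s \<longrightarrow> vec_index (P s) i \<le> vec_index (P t) i"
      by blast
  qed (use order_trans in force)
  with \<open>0 \<le> a\<close> show ?thesis
    by simp
qed

text \<open>Between consecutive integers the nondecreasing components, integral at both ends, have
  total increment 1, so exactly one of them grows. The others are squeezed between equal end values,
  and the sum then forces the growing one to be linear.\<close>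

lemma n_system_integral_discrete:
  assumes P: "n_system n P" and int: "\<And>m :: nat. \<And>i. i < n \<Longrightarrow> vec_index (P (real m)) i \<in> \<int>"
  obtains p k where "discrete_system n p k" "P = interpolation n p k"
proof -
  have nonneg: "0 \<le> vec_index (P q) i" if "0 \<le> q" "i < n" for q i
    using P that by (simp add: n_system_def)
  have sorted: "vec_index (P q) i \<le> vec_index (P q) j" if "0 \<le> q" "i \<le> j" "j < n" for q i j
    using P that by (simp add: n_system_def)
  have sum: "(\<Sum>i<n. vec_index (P q) i) = q" if "0 \<le> q" for q
    using P that by (simp add: n_system_def)
  have carrier: "P q \<in> carrier_vec n" if "0 \<le> q" for q
    using P that by (auto simp: n_system_def)
  define p where "p m i = nat \<lfloor>vec_index (P (real m)) i\<rfloor>" for m i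
  have p: "real (p m i) = vec_index (P (real m)) i" if "i < n" for m i
    using int[OF that] nonneg[of "real m" i] that by (auto simp: p_def elim!: Ints_cases)
  have mono: "p m i \<le> p (Suc m) i" if "i < n" for m i
    using n_system_mono[OF P that, of "real m" "real (Suc m)"] that by (simp flip: p del: of_nat_Suc)
  have "\<exists>k<n. p (Suc m) k - p m k = 1 \<and> (\<forall>i<n. k \<noteq> i \<longrightarrow> p (Suc m) i - p m i = 0)" for m
  proof -
    have psum: "(\<Sum>i<n. p m i) = m" for m
      using sum[of "real m"] by (simp flip: p of_nat_sum)
    have "(\<Sum>i<n. p (Suc m) i - p m i) = 1"
      using sum_subtractf_nat[of "{..<n}" "p m" "p (Suc m)"] mono by (simp add: psum)
    then show ?thesis
      by (subst (asm) sum_eq_1_iff) auto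
  qed
  then obtain k where k: "\<And>m. k m < n" "\<And>m. p (Suc m) (k m) - p m (k m) = 1"
    "\<And>m i. i < n \<Longrightarrow> k m \<noteq> i \<Longrightarrow> p (Suc m) i - p m i = 0"
    by metis
  have p_Suc: "p (Suc m) i = p m i + (if i = k m then 1 else 0)" if "i < n" for m i
    using k(2)[of m] k(3)[OF that, of m] mono[OF that, of m] by auto
  have P_eq: "P (real m + \<theta>) = vec n (\<lambda>i. real (p m i) + (if i = k m then \<theta> else 0))"
    if "0 \<le> \<theta>" "\<theta> \<le> 1" for m \<theta>
  proof -
    have const: "vec_index (P (real m + \<theta>)) i = real (p m i)" if "i < n" "i \<noteq> k m" for i
    proof (rule antisym)
      have "vec_index (P (real m + \<theta>)) i \<le> vec_index (P (real (Suc m))) i"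
        by (rule n_system_mono[OF P \<open>i < n\<close>]) (use \<open>0 \<le> \<theta>\<close> \<open>\<theta> \<le> 1\<close> in auto)
      also have "\<dots> = real (p (Suc m) i)"
        by (rule p[OF \<open>i < n\<close>, symmetric])
      also have "\<dots> = real (p m i)"
        using that by (simp add: p_Suc)
      finally show "vec_index (P (real m + \<theta>)) i \<le> real (p m i)" .
      show "real (p m i) \<le> vec_index (P (real m + \<theta>)) i"
        unfolding p[OF \<open>i < n\<close>]
        by (rule n_system_mono[OF P \<open>i < n\<close>]) (use \<open>0 \<le> \<theta>\<close> in auto)
    qed
    have "real m + \<theta> = vec_index (P (real m + \<theta>)) (k m) + (\<Sum>i\<in>{..<n} - {k m}. real (p m i))"
      using sum[of "real m + \<theta>"] k(1)[of m] const \<open>0 \<le> \<theta>\<close> by (simp add: sum.remove[of _ "k m"])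
    moreover have "real m = real (p m (k m)) + (\<Sum>i\<in>{..<n} - {k m}. real (p m i))"
      using sum[of "real m"] k(1)[of m] by (simp add: sum.remove[of _ "k m"] p)
    ultimately have "vec_index (P (real m + \<theta>)) (k m) = real (p m (k m)) + \<theta>"
      by simp
    then show ?thesis
      using const carrier[of "real m + \<theta>"] \<open>0 \<le> \<theta>\<close> by auto
  qed
  have S3: "p (Suc m) (k (Suc m)) = p (Suc m) (k m)" if "k m < k (Suc m)" for m
  proof -
    let ?q = "real (Suc m)"
    obtain \<epsilon> k' l' where "0 < \<epsilon>" "k' < n" "l' < n"
      and left: "\<forall>t. max 0 (?q - \<epsilon>) \<le> t \<and> t \<le> ?q \<longrightarrow> P t = P ?q + (t - ?q) \<cdot>\<^sub>v unit_vec n l'"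
      and right: "\<forall>t. ?q \<le> t \<and> t \<le> ?q + \<epsilon> \<longrightarrow> P t = P ?q + (t - ?q) \<cdot>\<^sub>v unit_vec n k'"
      and eq: "0 < ?q \<and> l' < k' \<longrightarrow> (\<forall>i. l' \<le> i \<and> i \<le> k' \<longrightarrow> vec_index (P ?q) i = vec_index (P ?q) l')"
      by (rule n_system_local[OF P of_nat_0_le_iff[of "Suc m"]])
    \<comment> \<open>The bound 1 keeps \<open>?q - \<delta>\<close> and
      \<open>?q + \<delta>\<close> in the two neighbouring unit intervals; evaluation there
      identifies \<open>l'\<close> and \<open>k'\<close> with \<open>k m\<close> and
      \<open>k (Suc m)\<close>.\<close>
    define \<delta> where "\<delta> = min \<epsilon> 1"
    have \<delta>: "0 < \<delta>" "\<delta> \<le> 1" "\<delta> \<le> \<epsilon>"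
      using \<open>0 < \<epsilon>\<close> by (auto simp: \<delta>_def)
    have Pq: "vec_index (P ?q) i = real (p m i) + (if i = k m then 1 else 0)" if "i < n" for i
      using that by (simp flip: p add: p_Suc del: of_nat_Suc)
    have "P (?q - \<delta>) = P ?q + (?q - \<delta> - ?q) \<cdot>\<^sub>v unit_vec n l'"
      using \<delta> by (intro left[THEN spec, THEN mp]) auto
    moreover have "P (?q - \<delta>) = vec n (\<lambda>i. real (p m i) + (if i = k m then 1 - \<delta> else 0))"
    proof -
      have eq: "?q - \<delta> = real m + (1 - \<delta>)"
        by simp
      show ?thesis
        unfolding eq by (rule P_eq) (use \<delta> in auto)
    qed
    ultimately have "vec_index (vec n (\<lambda>i. real (p m i) + (if i = k m then 1 - \<delta> else 0))) (k m) =
        vec_index (P ?q + (?q - \<delta> - ?q) \<cdot>\<^sub>v unit_vec n l') (k m)"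
      by simp
    then have "l' = k m"
      using k(1)[of m] \<delta> carrier[of ?q] Pq[of "k m"] by (auto simp: unit_vec_def split: if_splits)
    have "P (?q + \<delta>) = P ?q + (?q + \<delta> - ?q) \<cdot>\<^sub>v unit_vec n k'"
      using \<delta> by (intro right[THEN spec, THEN mp]) auto
    moreover have "P (?q + \<delta>) = vec n (\<lambda>i. real (p (Suc m) i) + (if i = k (Suc m) then \<delta> else 0))"
      using P_eq[of \<delta> "Suc m"] \<delta> by simp
    ultimately have "vec n (\<lambda>i. real (p (Suc m) i) + (if i = k (Suc m) then \<delta> else 0)) =
        P ?q + (?q + \<delta> - ?q) \<cdot>\<^sub>v unit_vec n k'"
      by (rule trans[OF sym, rotated])
    from arg_cong[OF this, of "\<lambda>x. vec_index x (k (Suc m))"]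
    have "real (p (Suc m) (k (Suc m))) + \<delta> =
        vec_index (P ?q) (k (Suc m)) + \<delta> * (if k' = k (Suc m) then 1 else 0)"
      using k(1)[of "Suc m"] carrier[of ?q] by (simp add: unit_vec_def eq_commute[of k'])
    then have "k' = k (Suc m)"
      unfolding p[OF k(1)] using \<delta>(1) by (simp split: if_splits)
    have "vec_index (P ?q) (k (Suc m)) = vec_index (P ?q) (k m)"
      by (rule eq[unfolded \<open>k' = _\<close> \<open>l' = _\<close>, THEN mp, THEN spec, THEN mp]) (use that in simp_all)
    then show ?thesis
      using k(1) by (simp flip: p del: of_nat_Suc)
  qed
  have "discrete_system n p k"
    unfolding discrete_system_def
  proof (intro conjI allI impI)
    show "p 0 i = 0" if "i < n" for i
    proof -
      have "(\<Sum>i<n. p 0 i) = 0"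
        using sum[of 0] by (simp flip: p[of _ 0, simplified] of_nat_sum)
      with that show ?thesis
        by simp
    qed
    show "p m i \<le> p m j" if "i \<le> j \<and> j < n" for m i j
      using sorted[of "real m" i j] that by (simp flip: p)
  qed (use k p_Suc S3 in auto)
  moreover have "P = interpolation n p k"
  proof
    fix q
    show "P q = interpolation n p k q"
    proof (cases "0 \<le> q")
      case True
      have "q = real (nat \<lfloor>q\<rfloor>) + frac q"
        using True by (simp add: frac_def)
      then have "P q = P (real (nat \<lfloor>q\<rfloor>) + frac q)"
        by simp
      also have "\<dots> = vec n (\<lambda>i. real (p (nat \<lfloor>q\<rfloor>) i) + (if i = k (nat \<lfloor>q\<rfloor>) then frac q else 0))"
        by (rule P_eq) (simp_all add: frac_lt_1 less_imp_le)
      finally show ?thesis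
        using True by (simp add: interpolation_def)
    next
      case False
      then show ?thesis
        using P by (auto simp: n_system_def interpolation_def PiE_def extensional_def)
    qed
  qed
  ultimately show thesis
    by (rule that)
qed


section \<open>Realizing a given system\<close>

text \<open>
  The index \<open>l\<close> is the one that has just grown. The last two clauses say how the residues depend on the
  coefficients \<open>v\<^sub>j\<close> of index \<open>m\<close> of the \<open>u\<^sub>j\<close>, which the previous steps leave undetermined: the
  residue at \<open>l\<close> does not depend on them, and those at \<open>i \<noteq> l\<close> can be prescribed arbitrarily.
\<close>

definition steerable ::
    "nat \<Rightarrow> (nat \<Rightarrow> 'a::field fls) \<Rightarrow> nat \<Rightarrow> (nat \<Rightarrow> nat) \<Rightarrow> (nat \<Rightarrow> nat \<Rightarrow> 'a poly) \<Rightarrow> nat \<Rightarrow> bool" where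
  "steerable n u m p X l \<longleftrightarrow> l < n \<and>
     reduced_basis n u (real m) (\<lambda>i. real (p i)) X \<and>
     residue n u m p X l \<noteq> 0 \<and>
     (\<forall>j<n. poly.coeff (X l j) (p l) = 0) \<and>
     (\<forall>a. \<exists>v. \<forall>i<n. i \<noteq> l \<longrightarrow> (\<Sum>j<n. v j * poly.coeff (X i j) (p i)) = a i)"

text \<open>For a growing index that moves up from \<open>l\<close> to \<open>k\<close>: (S3)
  supplies \<open>p l = p k\<close>, and exchanging the two vectors makes \<open>k\<close> the
  distinguished index.\<close>

lemma steerable_transpose:
  assumes st: "steerable n u m p X l" and k: "k < n" "p l = p k"
  shows "steerable n u m p (X \<circ> transpose l k) k"
proof -
  let ?\<tau> = "transpose l k"
  have p\<tau>: "p (?\<tau> i) = p i" for i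
    using k by (metis transpose_apply_first transpose_apply_other transpose_apply_second)
  have "\<exists>v. \<forall>i<n. i \<noteq> k \<longrightarrow> (\<Sum>j<n. v j * poly.coeff ((X \<circ> ?\<tau>) i j) (p i)) = a i" for a
  proof -
    obtain v where v: "\<And>i. i < n \<Longrightarrow> i \<noteq> l \<Longrightarrow> (\<Sum>j<n. v j * poly.coeff (X i j) (p i)) = (a \<circ> ?\<tau>) i"
      using st unfolding steerable_def by blast
    have "(\<Sum>j<n. v j * poly.coeff ((X \<circ> ?\<tau>) i j) (p i)) = a i" if "i < n" "i \<noteq> k" for i
    proof -
      have "?\<tau> i < n" "?\<tau> i \<noteq> l"
        using that st k by (auto simp: steerable_def transpose_def)
      from v[OF this] show ?thesis
        by (simp add: p\<tau>)
    qed
    then show ?thesis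
      by blast
  qed
  moreover have "reduced_basis n u (real m) (\<lambda>i. real (p i)) (X \<circ> ?\<tau>)"
    using st k by (intro reduced_basis_transpose) (auto simp: steerable_def)
  ultimately show ?thesis
    using st k by (simp add: steerable_def residue_transpose)
qed

definition series :: "(nat \<Rightarrow> nat \<Rightarrow> 'a) \<Rightarrow> nat \<Rightarrow> 'a::field fls" where
  "series w j = fps_to_fls (Abs_fps (\<lambda>s. w s j))"

lemma fls_nth_series: "fls_nth (series w j) k = (if k < 0 then 0 else w (nat k) j)"
  by (simp add: series_def)

text \<open>The coefficient of index \<open>m\<close> in \<open>series w j\<close> reaches index
  \<open>m - p i\<close> of \<open>u \<bullet> X i\<close> only through the term of degree
  \<open>p i\<close> in \<open>X i j\<close>.\<close>

lemma residue_series_upd: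
  assumes red: "reduced_basis n (series w) (real m) (\<lambda>i. real (p i)) X" and "i < n"
  shows "residue n (series (w(m := \<lambda>j. w m j + v j))) m p X i =
    residue n (series w) m p X i + (\<Sum>j<n. v j * poly.coeff (X i j) (p i))"
proof -
  let ?w = "w(m := \<lambda>j. w m j + v j)"
  let ?k = "int m - int (p i)"
  have summand: "(\<Sum>d\<le>degree (X i j). poly.coeff (X i j) d * fls_nth (series ?w j) (?k + int d)) =
      (\<Sum>d\<le>degree (X i j). poly.coeff (X i j) d * fls_nth (series w j) (?k + int d)) +
      v j * poly.coeff (X i j) (p i)" if "j < n" for j
  proof -
    have "poly.coeff (X i j) d * fls_nth (series ?w j) (?k + int d) =
        poly.coeff (X i j) d * fls_nth (series w j) (?k + int d) +
        (if d = p i then v j * poly.coeff (X i j) (p i) else 0)" for d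
      by (auto simp: fls_nth_series algebra_simps)
    then show ?thesis
      by (simp add: sum.distrib coeff_eq_0)
  qed
  show ?thesis
    unfolding residue_def fls_nth_linear_form using summand by (simp add: sum.distrib)
qed

lemma coeff_reduced_basis_eq_0:
  assumes "reduced_basis n u (real m) (\<lambda>i. real (p i)) X" "i < n" "j < n" "p i < d"
  shows "poly.coeff (X i j) d = 0"
  using reduced_basis_in_body[OF assms(1,2)] assms(3,4) unfolding in_body_def by fastforce

text \<open>The coefficients of index \<open>m\<close> are adjusted until the residues are nonzero
  at \<open>k\<close> and \<open>l\<close> and zero elsewhere; then \<open>p k \<le> p l\<close>
  lets \<open>k\<close> grow. Clearing changes at most \<open>X l\<close>. If
  \<open>k \<noteq> l\<close>, its coefficient vector in degree \<open>p l\<close> becomes a nonzero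
  multiple of that of \<open>X k\<close> in degree \<open>p k\<close>, so the freedom at indices
  other than \<open>l\<close> becomes freedom at indices other than \<open>k\<close>.\<close>

lemma steerable_step:
  assumes st: "steerable n (series w) m p X l" and k: "k < n" "p k \<le> p l"
  obtains w' X' where "\<And>s. s < m \<Longrightarrow> w' s = w s"
    "steerable n (series w') (Suc m) (\<lambda>i. p i + (if i = k then 1 else 0)) X' k"
proof -
  let ?p' = "\<lambda>i. p i + (if i = k then 1 else 0)"
  have l: "l < n" and red: "reduced_basis n (series w) (real m) (\<lambda>i. real (p i)) X"
    and res_l: "residue n (series w) m p X l \<noteq> 0"
    and lead_l: "\<And>j. j < n \<Longrightarrow> poly.coeff (X l j) (p l) = 0"
    and surj: "\<And>a. \<exists>v. \<forall>i<n. i \<noteq> l \<longrightarrow> (\<Sum>j<n. v j * poly.coeff (X i j) (p i)) = a i"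
    using st unfolding steerable_def by blast+
  obtain v where v: "\<And>i. i < n \<Longrightarrow> i \<noteq> l \<Longrightarrow> (\<Sum>j<n. v j * poly.coeff (X i j) (p i)) =
      (if i = k then 1 else 0) - residue n (series w) m p X i"
    using surj[of "\<lambda>i. (if i = k then 1 else 0) - residue n (series w) m p X i"] by blast
  define w' where "w' = w(m := \<lambda>j. w m j + v j)"
  define r where "r = residue n (series w') m p X"
  have red': "reduced_basis n (series w') (real m) (\<lambda>i. real (p i)) X"
    by (rule iffD1[OF reduced_basis_cong red]) (auto simp: fls_nth_series w'_def split: if_splits)
  have r_l: "r l \<noteq> 0"
    using res_l lead_l residue_series_upd[OF red l, of v] by (simp add: r_def w'_def)
  have r: "r i = (if i = k then 1 else 0)" if "i < n" "i \<noteq> l" for i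
    using residue_series_upd[OF red that(1), of v] v[OF that] by (simp add: r_def w'_def)
  have r_k: "r k \<noteq> 0"
    using r[OF k(1)] r_l by (cases "k = l") auto
  have min: "p k \<le> p i" if "i < n" "r i \<noteq> 0" for i
    using r[OF that(1)] that k by (cases "i = l") (auto split: if_splits)
  define X' where "X' = (\<lambda>i j. if i = k then X k j else X i j - Polynomial.monom (r i / r k) (p i - p k) * X k j)"
  have redX': "reduced_basis n (series w') (real m) (\<lambda>i. real (p i)) X'"
    unfolding X'_def r_def
    by (rule reduced_basis_clear(1)[OF red' k(1)]) (use r_k min in \<open>auto simp: r_def\<close>)
  have resX': "residue n (series w') m p X' i = (if i = k then r k else 0)" if "i < n" for i
    unfolding X'_def r_def
    by (rule reduced_basis_clear(2)[OF red' k(1) _ _ that]) (use r_k min in \<open>auto simp: r_def\<close>)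
  have red_step: "reduced_basis n (series w') (real (Suc m)) (\<lambda>i. real (?p' i)) X'"
  proof -
    have "(\<lambda>i. real (?p' i)) = (\<lambda>i. real (p i) + (if i = k then 1 else 0))"
      by auto
    then show ?thesis
      using reduced_basis_step[OF redX' k(1), of 1] resX' r_k by (simp add: k add.commute)
  qed
  have "\<exists>v. \<forall>i<n. i \<noteq> k \<longrightarrow> (\<Sum>j<n. v j * poly.coeff (X' i j) (?p' i)) = a i" for a
  proof -
    \<comment> \<open>The value at \<open>k\<close> is scaled so that its multiple by
      \<open>- (r l / r k)\<close>, which clearing produces at \<open>l\<close>, equals
      \<open>a l\<close>.\<close>
    obtain v where v: "\<And>i. i < n \<Longrightarrow> i \<noteq> l \<Longrightarrow> (\<Sum>j<n. v j * poly.coeff (X i j) (p i)) =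
        (if i = k then - (r k / r l) * a l else a i)"
      using surj[of "\<lambda>i. if i = k then - (r k / r l) * a l else a i"] by blast
    have "(\<Sum>j<n. v j * poly.coeff (X' i j) (?p' i)) = a i" if i: "i < n" "i \<noteq> k" for i
    proof (cases "i = l")
      case False
      then have "X' i j = X i j" for j
        using i by (simp add: X'_def r)
      then show ?thesis
        using i False v[OF i(1) False] by simp
    next
      case True
      have "poly.coeff (X' l j) (p l) = - (r l / r k) * poly.coeff (X k j) (p k)" if "j < n" for j
        using i True k(2) lead_l[OF that] by (simp add: X'_def coeff_monom_mult)
      then have "(\<Sum>j<n. v j * poly.coeff (X' l j) (p l)) =
          (\<Sum>j<n. - (r l / r k) * (v j * poly.coeff (X k j) (p k)))"
        by (intro sum.cong) (simp_all add: mult.left_commute)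
      also have "\<dots> = - (r l / r k) * (\<Sum>j<n. v j * poly.coeff (X k j) (p k))"
        by (rule sum_distrib_left[symmetric])
      also have "\<dots> = a l"
        using v[OF k(1)] i True r_l r_k by simp
      finally show ?thesis
        using i True by simp
    qed
    then show ?thesis
      by blast
  qed
  moreover have "residue n (series w') (Suc m) ?p' X' k \<noteq> 0"
    using resX'[OF k(1)] r_k by (simp add: residue_def)
  \<comment> \<open>\<open>X' k\<close> has degrees at most \<open>p k\<close>, one less than the
    new extremal degree.\<close>
  moreover have "poly.coeff (X' k j) (?p' k) = 0" if "j < n" for j
    using coeff_reduced_basis_eq_0[OF redX' k(1) that, of "Suc (p k)"] by simp
  ultimately have "steerable n (series w') (Suc m) ?p' X' k"
    using red_step k(1) unfolding steerable_def by blast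
  then show thesis
    by (rule that[rotated]) (simp add: w'_def)
qed

text \<open>The construction starts at parameter 1, because at 0 no vector has grown. With the unit
  vector of index \<open>k\<close> as constant term of \<open>u\<close>, the standard basis has
  residue 1 at \<open>k\<close> and 0 elsewhere.\<close>

lemma steerable_start:
  assumes "k < n"
  shows "steerable n (series (\<lambda>s j. if s = 0 \<and> j = k then 1 else 0)) 1
    (\<lambda>i. if i = k then 1 else 0) (\<lambda>i j. if i = j then 1 else 0 :: 'a::field poly) k"
proof -
  let ?u = "series (\<lambda>s j. if s = 0 \<and> j = k then 1 else 0 :: 'a)"
  let ?X = "\<lambda>i j. if i = j then 1 else 0 :: 'a poly"
  have lf: "linear_form n ?u (?X i) = ?u i" if "i < n" for i
    using that by (simp add: linear_form_def poly_to_fls_1 if_distrib[of poly_to_fls]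
        if_distrib[of "\<lambda>y. _ * y"] cong: if_cong)
  have red: "reduced_basis n ?u (real 0) (\<lambda>i. real ((\<lambda>_. 0) i)) ?X"
    using reduced_basis_unit[of n ?u] by (simp add: fls_nth_series)
  have res: "residue n ?u 0 (\<lambda>_. 0) ?X i = (if i = k then 1 else 0)" if "i < n" for i
    by (simp add: residue_def lf[OF that] fls_nth_series)
  have eq: "(\<lambda>i. real (if i = k then 1 else 0)) = (\<lambda>i. if i = k then 1 else 0)"
    by auto
  have "reduced_basis n ?u (real 1) (\<lambda>i. real (if i = k then 1 else 0)) ?X"
    using reduced_basis_step[OF red assms, of 1] res assms unfolding eq by simp
  moreover have "residue n ?u 1 (\<lambda>i. if i = k then 1 else 0) ?X k \<noteq> 0"
    by (simp add: residue_def lf[OF assms] fls_nth_series)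
  moreover have "\<exists>v. \<forall>i<n. i \<noteq> k \<longrightarrow>
      (\<Sum>j<n. v j * poly.coeff (?X i j) (if i = k then 1 else 0)) = a i" for a
    by (intro exI[of _ a]) (simp add: if_distrib[of "\<lambda>y. poly.coeff y _"]
        if_distrib[of "\<lambda>y. _ * y"] cong: if_cong)
  moreover have "poly.coeff (?X k j) (if k = k then 1 else 0) = 0" for j
    by simp
  ultimately show ?thesis
    using assms unfolding steerable_def by blast
qed

theorem exists_linear_form:
  assumes d: "discrete_system n p k"
  obtains u :: "nat \<Rightarrow> 'a::field fls" where
    "\<forall>j. \<forall>i<0. fls_nth (u j) i = 0" "fls_nth (u (k 0)) 0 \<noteq> 0"
    "\<forall>m. \<exists>X. reduced_basis n u (real (Suc m)) (\<lambda>i. real (p (Suc m) i)) X"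
proof -
  note d = discrete_systemD[OF d]
  \<comment> \<open>State \<open>m\<close> belongs to parameter \<open>m + 1\<close>, which sees the
    coefficients of index at most \<open>m\<close>; \<open>Q\<close> freezes these. Padding with 0
    from \<open>n\<close> on turns equalities below \<open>n\<close> into equalities of
    functions.\<close>
  define P where "P m s \<longleftrightarrow> (case s of (w, X) \<Rightarrow>
      steerable n (series w) (Suc m) (\<lambda>i. if i < n then p (Suc m) i else 0) X (k m) \<and> w 0 (k 0) \<noteq> 0)"
    for m and s :: "(nat \<Rightarrow> nat \<Rightarrow> 'a) \<times> (nat \<Rightarrow> nat \<Rightarrow> 'a poly)"
  define Q where "Q m s s' \<longleftrightarrow> (\<forall>i\<le>m. fst s' i = fst s i)"
    for m and s s' :: "(nat \<Rightarrow> nat \<Rightarrow> 'a) \<times> (nat \<Rightarrow> nat \<Rightarrow> 'a poly)"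
  have "\<exists>f. \<forall>m. P m (f m) \<and> Q m (f m) (f (Suc m))"
  proof (rule dependent_nat_choice)
    have "(\<lambda>i. if i < n then p (Suc 0) i else 0) = (\<lambda>i. if i = k 0 then 1 else 0)"
      using d(1) d(2)[of 0] d(3)[of _ 0] by auto
    then show "\<exists>s. P 0 s"
      using steerable_start[OF d(2)[of 0]] unfolding P_def
      by (intro exI[of _ "(\<lambda>s j. if s = 0 \<and> j = k 0 then 1 else 0, \<lambda>i j. if i = j then 1 else 0)"]) simp
  next
    fix s m assume "P m s"
    define p' where "p' = (\<lambda>i. if i < n then p (Suc m) i else 0)"
    obtain w X where s: "s = (w, X)" and st: "steerable n (series w) (Suc m) p' X (k m)"
      and w0: "w 0 (k 0) \<noteq> 0"
      using \<open>P m s\<close> by (auto simp: P_def p'_def)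
    \<comment> \<open>A growing index that moves up is reached by exchanging vectors of equal value;
      for one that stays or moves down the order gives the inequality.\<close>
    have "\<exists>Y l. steerable n (series w) (Suc m) p' Y l \<and> p' (k (Suc m)) \<le> p' l"
    proof (cases "k m < k (Suc m)")
      case True
      then have "p' (k m) = p' (k (Suc m))"
        using d(5)[OF True] d(2) by (simp add: p'_def)
      from steerable_transpose[OF st d(2) this] show ?thesis
        by blast
    next
      case False
      then have "p' (k (Suc m)) \<le> p' (k m)"
        using d(2) d(4)[of "k (Suc m)" "k m" "Suc m"] by (simp add: p'_def)
      with st show ?thesis
        by blast
    qed
    then obtain Y l where "steerable n (series w) (Suc m) p' Y l" "p' (k (Suc m)) \<le> p' l"
      by blast
    from steerable_step[OF this(1) d(2) this(2)] obtain w' X' where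
      w': "\<And>s. s < Suc m \<Longrightarrow> w' s = w s"
      and st': "steerable n (series w') (Suc (Suc m)) (\<lambda>i. p' i + (if i = k (Suc m) then 1 else 0)) X' (k (Suc m))"
      by blast
    have "(\<lambda>i. p' i + (if i = k (Suc m) then 1 else 0)) = (\<lambda>i. if i < n then p (Suc (Suc m)) i else 0)"
      using d(2)[of "Suc m"] d(3)[of _ "Suc m"] by (auto simp: p'_def)
    then have "P (Suc m) (w', X')"
      using st' w0 w' by (simp add: P_def)
    moreover have "Q m s (w', X')"
      using w' by (simp add: Q_def s less_Suc_eq_le)
    ultimately show "\<exists>s'. P (Suc m) s' \<and> Q m s s'"
      by blast
  qed
  then obtain f where f: "\<And>m. P m (f m)" "\<And>m. Q m (f m) (f (Suc m))"
    by blast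
  \<comment> \<open>Coefficient \<open>s\<close> is final from state \<open>s\<close> on, so this
    diagonal agrees with state \<open>m\<close> up to index \<open>m\<close> and inherits its
    reduced basis.\<close>
  define W where "W s = fst (f s) s" for s
  have W: "W s = fst (f m) s" if "s \<le> m" for s m
    using that
  proof (induction m rule: dec_induct)
    case base
    then show ?case
      by (simp add: W_def)
  next
    case (step m)
    then show ?case
      using f(2)[of m] by (simp add: Q_def)
  qed
  show thesis
  proof (rule that[of "series W"])
    show "fls_nth (series W (k 0)) 0 \<noteq> 0"
      using f(1)[of 0] by (auto simp: fls_nth_series W_def P_def split: prod.splits)
    show "\<forall>m. \<exists>X. reduced_basis n (series W) (real (Suc m)) (\<lambda>i. real (p (Suc m) i)) X"
    proof
      fix m
      have "reduced_basis n (series (fst (f m))) (real (Suc m))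
          (\<lambda>i. real (if i < n then p (Suc m) i else 0)) (snd (f m))"
        using f(1)[of m] by (auto simp: P_def steerable_def split: prod.splits)
      then have "reduced_basis n (series W) (real (Suc m))
          (\<lambda>i. real (if i < n then p (Suc m) i else 0)) (snd (f m))"
        using reduced_basis_cong[of n "Suc m" "series W" "series (fst (f m))"]
        by (simp add: fls_nth_series W[of _ m] del: of_nat_Suc)
      then show "\<exists>X. reduced_basis n (series W) (real (Suc m)) (\<lambda>i. real (p (Suc m) i)) X"
        by (auto simp: reduced_basis_def weighted_degrees_le_def)
    qed
  qed (simp add: fls_nth_series)
qed

section \<open>The two inclusions\<close>

lemma L_map_eq_interpolation:
  fixes u :: "'a::field fls vec"
  assumes "0 < n" and d: "discrete_system n p k"
    and red: "\<And>m \<theta>. 0 \<le> \<theta> \<Longrightarrow> \<theta> \<le> 1 \<Longrightarrow>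
       \<exists>X. reduced_basis n (vec_index u) (real m + \<theta>) (\<lambda>i. real (p m i) + (if i = k m then \<theta> else 0)) X"
  shows "L_map n u = interpolation n p k"
proof
  fix q
  show "L_map n u q = interpolation n p k q"
  proof (cases "0 \<le> q")
    case True
    have fr: "0 \<le> frac q" "frac q \<le> 1"
      by (simp_all add: frac_lt_1 less_imp_le)
    have q: "real (nat \<lfloor>q\<rfloor>) + frac q = q"
      using True by (simp add: frac_def)
    obtain X where "reduced_basis n (vec_index u) q
        (\<lambda>i. real (p (nat \<lfloor>q\<rfloor>) i) + (if i = k (nat \<lfloor>q\<rfloor>) then frac q else 0)) X"
      using red[OF fr, of "nat \<lfloor>q\<rfloor>"] unfolding q by blast
    from L_coord_eqI[OF \<open>0 < n\<close> _ this] discrete_system_sorted[OF d _ _ fr] fr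
    have "L_coord n u i q = real (p (nat \<lfloor>q\<rfloor>) i) + (if i = k (nat \<lfloor>q\<rfloor>) then frac q else 0)"
      if "i < n" for i
      using that by simp
    then show ?thesis
      using True by (auto simp: L_map_def interpolation_def)
  qed (simp add: L_map_def interpolation_def)
qed

theorem L_map_discrete_system:
  fixes u :: "'a::field fls vec"
  assumes "0 < n" "u \<in> carrier_vec n" "max_norm u = 1"
  obtains p k where "discrete_system n p k" "L_map n u = interpolation n p k"
proof -
  obtain j where j: "\<forall>j<n. \<forall>k<0. fls_nth (vec_index u j) k = 0" "j < n" "fls_nth (vec_index u j) 0 \<noteq> 0"
    using assms max_norm_eq_1_iff[of n u] by auto
  obtain p k where "discrete_system n p k" and
    "\<And>m \<theta>. 0 \<le> \<theta> \<Longrightarrow> \<theta> \<le> 1 \<Longrightarrow>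
       \<exists>X. reduced_basis n (vec_index u) (real m + \<theta>) (\<lambda>i. real (p m i) + (if i = k m then \<theta> else 0)) X"
    using exists_discrete_system[of n "vec_index u" j] j by blast
  with L_map_eq_interpolation[OF \<open>0 < n\<close>] that show thesis
    by blast
qed

text \<open>The index \<open>k m\<close> is recovered as the only component that changes between
  \<open>m\<close> and \<open>m + 1\<close>, so the integer values determine the path.\<close>

lemma interpolation_eqI:
  assumes "discrete_system n p k" "discrete_system n p' k'"
    and "\<And>m i. i < n \<Longrightarrow> p (Suc m) i = p' (Suc m) i"
  shows "interpolation n p k = interpolation n p' k'"
proof -
  note d = discrete_systemD[OF assms(1)] and d' = discrete_systemD[OF assms(2)]
  have p: "p m i = p' m i" if "i < n" for m i
    using that assms(3) d(1) d'(1) by (cases m) simp_all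
  have "k m = k' m" for m
    using d(2)[of m] d(3)[of "k m" m] d'(3)[of "k m" m] p[of "k m" m] p[of "k m" "Suc m"]
    by (simp split: if_splits)
  then show ?thesis
    using p by (auto simp: interpolation_def intro!: restrict_ext)
qed

text \<open>The constructed vector is controlled at positive integers. Its \<open>L_map\<close> is
  already known to interpolate some discrete system, and agreement at positive integers identifies
  that interpolation with the prescribed one.\<close>

theorem exists_L_map:
  assumes "0 < n" and d: "discrete_system n p k"
  obtains u :: "'a::field fls vec" where
    "u \<in> carrier_vec n" "max_norm u = 1" "L_map n u = interpolation n p k"
proof -
  obtain w :: "nat \<Rightarrow> 'a fls" where w: "\<forall>j. \<forall>i<0. fls_nth (w j) i = 0" "fls_nth (w (k 0)) 0 \<noteq> 0"
    and red: "\<forall>m. \<exists>X. reduced_basis n w (real (Suc m)) (\<lambda>i. real (p (Suc m) i)) X"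
    by (rule exists_linear_form[OF d])
  define u where "u = vec n w"
  have u: "u \<in> carrier_vec n" "max_norm u = 1"
    using w discrete_systemD(2)[OF d, of 0] \<open>0 < n\<close> max_norm_eq_1_iff[of n u] by (auto simp: u_def)
  obtain p' k' where d': "discrete_system n p' k'" and L: "L_map n u = interpolation n p' k'"
    using L_map_discrete_system[OF \<open>0 < n\<close> u] by blast
  have "p (Suc m) i = p' (Suc m) i" if "i < n" for m i
  proof -
    obtain X where "reduced_basis n w (real (Suc m)) (\<lambda>i. real (p (Suc m) i)) X"
      using red by blast
    then have "reduced_basis n (vec_index u) (real (Suc m)) (\<lambda>i. real (p (Suc m) i)) X"
      using reduced_basis_cong[of n "Suc m" w "vec_index u"] by (simp add: u_def del: of_nat_Suc)
    then have "L_coord n u i (real (Suc m)) = real (p (Suc m) i)"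
      using L_coord_eqI[OF \<open>0 < n\<close> \<open>i < n\<close>, of u "real (Suc m)" "\<lambda>i. real (p (Suc m) i)" X]
        discrete_systemD(4)[OF d] by simp
    moreover have "vec_index (L_map n u (real (Suc m))) i = real (p' (Suc m) i)"
      using interpolation_at[OF d', of 0 "Suc m"] \<open>i < n\<close> by (simp add: L)
    ultimately show ?thesis
      using \<open>i < n\<close> by (simp add: L_map_def)
  qed
  then have "interpolation n p k = interpolation n p' k'"
    by (rule interpolation_eqI[OF d d'])
  with u L show thesis
    by (intro that[of u]) simp_all
qed

theorem theoremA:
  fixes n :: nat
  assumes "n \<ge> 2"
  shows "{L_map n u | u :: 'a::field fls vec. u \<in> carrier_vec n \<and> max_norm u = 1} =
         {P. n_system n P \<and> (\<forall>q::nat. \<forall>i<n. P (real q) $ i \<in> \<int>)}"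
proof (intro equalityI subsetI)
  have "0 < n"
    using assms by simp
  {
    fix P assume "P \<in> {L_map n u | u :: 'a fls vec. u \<in> carrier_vec n \<and> max_norm u = 1}"
    then obtain u :: "'a fls vec" where "u \<in> carrier_vec n" "max_norm u = 1" "P = L_map n u"
      by blast
    then obtain p k where "discrete_system n p k" "P = interpolation n p k"
      using L_map_discrete_system[OF \<open>0 < n\<close>] by metis
    then show "P \<in> {P. n_system n P \<and> (\<forall>q::nat. \<forall>i<n. P (real q) $ i \<in> \<int>)}"
      using n_system_interpolation interpolation_integral by auto
  next
    fix P assume "P \<in> {P. n_system n P \<and> (\<forall>q::nat. \<forall>i<n. P (real q) $ i \<in> \<int>)}"
    then obtain p k where "discrete_system n p k" "P = interpolation n p k"
      using n_system_integral_discrete[of n P] by blast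
    then obtain u :: "'a fls vec" where "u \<in> carrier_vec n" "max_norm u = 1" "L_map n u = P"
      using exists_L_map[OF \<open>0 < n\<close>] by metis
    then show "P \<in> {L_map n u | u :: 'a fls vec. u \<in> carrier_vec n \<and> max_norm u = 1}"
      by blast
  }
qed


end
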